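(* Let $q$ be a prime power and $N>2$ an integer. Let $P$ be the first eigenmatrix of the association scheme of $N\times N$ Hermitian forms over $\mathbb{F}_{q^2}$ (with respect to the standard self-dual ordering). Then there is no diagonal complex matrix $T$ with $(PT)^3=I$.
   Context: The Hermitian forms scheme has point set the $N\times N$ Hermitian matrices over $\mathbb{F}_{q^2}$, with $(A,B)\in R_i$ iff $\operatorname{rank}(A-B)=i$, $0\le i\le N$. It is a self-dual P-polynomial association scheme; $P$ is the matrix with $(i,j)$ entry $P_j(i)$ where $A_j=\sum_i P_j(i)E_i$ ($A_j$ adjacency matrices, $E_i$ primitive idempotents), with relations ordered by rank and idempotents ordered so that $P=Q$ (the Q-polynomial ordering). For a diagonal $T=\mathrm{diag}(T_0,\dots,T_N)$, $PT$ has $(i,j)$ entry $P_j(i)T_j$. *)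

theory Defs
  imports
    "Jordan_Normal_Form.DL_Rank"
    "HOL-Number_Theory.Prime_Powers"
    "HOL-Library.Cardinality"
begin

text \<open>
  A complex matrix with rows and columns indexed by a finite point set \<open>X\<close> is represented
  by a function \<open>'x \<Rightarrow> 'x \<Rightarrow> complex\<close>. For relations on \<open>X\<close> (subsets of \<open>X \<times> X\<close>), the elements
  of the span of their adjacency matrices vanish outside \<open>X \<times> X\<close>, so equality of such functions is
  equality of matrices.
\<close>

definition adj_matrix :: "('x \<times> 'x) set \<Rightarrow> 'x \<Rightarrow> 'x \<Rightarrow> complex" where
  "adj_matrix S = (\<lambda>x y. if (x, y) \<in> S then 1 else 0)"

definition mat_prod :: "'x set \<Rightarrow> ('x \<Rightarrow> 'x \<Rightarrow> complex) \<Rightarrow> ('x \<Rightarrow> 'x \<Rightarrow> complex) \<Rightarrow> 'x \<Rightarrow> 'x \<Rightarrow> complex" where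
  "mat_prod X M L = (\<lambda>x y. \<Sum>z\<in>X. M x z * L z y)"

definition bose_mesner :: "(nat \<Rightarrow> ('x \<times> 'x) set) \<Rightarrow> nat \<Rightarrow> ('x \<Rightarrow> 'x \<Rightarrow> complex) set" where
  "bose_mesner R d =
     {M. \<exists>c. \<forall>x y. M x y = (\<Sum>j\<le>d. c j * adj_matrix (R j) x y)}"

definition idempotents :: "'x set \<Rightarrow> (nat \<Rightarrow> ('x \<times> 'x) set) \<Rightarrow> nat \<Rightarrow> ('x \<Rightarrow> 'x \<Rightarrow> complex) set" where
  "idempotents X R d = {M \<in> bose_mesner R d. mat_prod X M M = M}"

definition primitive_idempotents ::
    "'x set \<Rightarrow> (nat \<Rightarrow> ('x \<times> 'x) set) \<Rightarrow> nat \<Rightarrow> ('x \<Rightarrow> 'x \<Rightarrow> complex) set" where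
  "primitive_idempotents X R d =
     {M \<in> idempotents X R d. M \<noteq> (\<lambda>_ _. 0) \<and>
        (\<forall>F \<in> idempotents X R d. mat_prod X F M = F \<and> mat_prod X M F = F \<longrightarrow>
           F = (\<lambda>_ _. 0) \<or> F = M)}"

text \<open>
  First eigenmatrix: \<open>A\<^sub>j = \<Sum>\<^sub>i P\<^sub>j(i) E\<^sub>i\<close> with \<open>P $$ (i, j) = P\<^sub>j(i)\<close>. Second eigenmatrix:
  \<open>|X| E\<^sub>j = \<Sum>\<^sub>i Q\<^sub>j(i) A\<^sub>i\<close> with \<open>Q $$ (i, j) = Q\<^sub>j(i)\<close>.
\<close>

definition is_first_eigenmatrix ::
    "(nat \<Rightarrow> ('x \<times> 'x) set) \<Rightarrow> nat \<Rightarrow> (nat \<Rightarrow> 'x \<Rightarrow> 'x \<Rightarrow> complex) \<Rightarrow> complex mat \<Rightarrow> bool" where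
  "is_first_eigenmatrix R d E P \<longleftrightarrow>
     P \<in> carrier_mat (d + 1) (d + 1) \<and>
     (\<forall>j\<le>d. \<forall>x y. adj_matrix (R j) x y = (\<Sum>i\<le>d. P $$ (i, j) * E i x y))"

definition is_second_eigenmatrix ::
    "'x set \<Rightarrow> (nat \<Rightarrow> ('x \<times> 'x) set) \<Rightarrow> nat \<Rightarrow> (nat \<Rightarrow> 'x \<Rightarrow> 'x \<Rightarrow> complex) \<Rightarrow> complex mat \<Rightarrow> bool" where
  "is_second_eigenmatrix X R d E Q \<longleftrightarrow>
     Q \<in> carrier_mat (d + 1) (d + 1) \<and>
     (\<forall>j\<le>d. \<forall>x y. of_nat (card X) * E j x y = (\<Sum>i\<le>d. Q $$ (i, j) * adj_matrix (R i) x y))"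

text \<open>
  Over a field with \<open>q\<^sup>2\<close> elements, \<open>x \<mapsto> x ^ q\<close> is the involutory automorphism that defines the
  conjugate transpose.
\<close>

definition hermitian_forms :: "nat \<Rightarrow> nat \<Rightarrow> 'a::field mat set" where
  "hermitian_forms q N =
     {A \<in> carrier_mat N N. map_mat (\<lambda>x. x ^ q) (transpose_mat A) = A}"

definition hermitian_rel :: "nat \<Rightarrow> nat \<Rightarrow> nat \<Rightarrow> ('a::field mat \<times> 'a mat) set" where
  "hermitian_rel q N i =
     {(A, B). A \<in> hermitian_forms q N \<and> B \<in> hermitian_forms q N \<and> vec_space.rank N (A - B) = i}"

text \<open>
  An ordering of the primitive idempotents for which the first and second eigenmatrices coincide.
  Together with the ordering of the relations by rank (a P-polynomial ordering) this forces the
  ordering to be Q-polynomial and \<open>E 0\<close> to be the all-ones matrix divided by \<open>|X|\<close>; since the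
  valencies of the Hermitian forms scheme are pairwise distinct for \<open>N > 2\<close>, there is exactly one
  such ordering.
\<close>

definition self_dual_ordering ::
    "'x set \<Rightarrow> (nat \<Rightarrow> ('x \<times> 'x) set) \<Rightarrow> nat \<Rightarrow> (nat \<Rightarrow> 'x \<Rightarrow> 'x \<Rightarrow> complex) \<Rightarrow> bool" where
  "self_dual_ordering X R d E \<longleftrightarrow>
     bij_betw E {..d} (primitive_idempotents X R d) \<and>
     (\<exists>P Q. is_first_eigenmatrix R d E P \<and> is_second_eigenmatrix X R d E Q \<and> P = Q)"

end

theory Submission
  imports Defs "HOL-Number_Theory.Residues"
begin

text \<open>
  Put \<open>B = -q\<close>. Every rank one form is \<open>v v\<^sup>*\<close> for exactly \<open>q + 1\<close> vectors \<open>v\<close>, and counting the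
  \<open>v\<close> for which \<open>A - v v\<^sup>*\<close> has a given rank yields the tridiagonal matrix \<open>L\<close> by which
  \<open>(q + 1) A\<^sub>1\<close> acts on the \<open>A\<^sub>j\<close>. With \<open>\<Theta>\<close> the diagonal matrix of the eigenvalues
  \<open>\<theta>\<^sub>i = (q + 1) P\<^sub>1(i)\<close> one has \<open>\<Theta> P = P L\<close>, and since \<open>P\<^sup>2\<close> is scalar also \<open>P \<Theta> = L P\<close>. Vectors
  with entries polynomial in \<open>B\<^bsup>-j\<^esup>\<close> triangularise \<open>L\<close>, so each \<open>\<theta>\<^sub>i\<close> has the form
  \<open>B\<^bsup>2N-m\<^esup> - 1\<close>; a \<open>B\<close>-adic argument shows that self-duality forces \<open>m = i\<close>.

  If \<open>(P T)\<^sup>3 = I\<close> with \<open>T\<close> diagonal, then \<open>T P T\<close> and \<open>T\<^sup>-\<^sup>1 P T\<^sup>-\<^sup>1\<close> commute with \<open>L\<close>.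
  Eliminating the entries of \<open>T\<close> from four of the resulting scalar equations leaves
  \<open>(B + 1) (m - B\<^sup>2) (m\<^sup>2 - B\<^sup>2)\<^sup>2 = 0\<close> for \<open>m = B\<^sup>N\<close>, which is false when \<open>N > 2\<close>.
\<close>

section \<open>Finite fields of square order\<close>

text \<open>No closed formula for the entries of \<open>P\<close> is used. Its column
  \<open>0\<close> is constant, column \<open>1\<close> holds the eigenvalues up to the factor
  \<open>q + 1\<close>, and the recurrence given by \<open>L\<close> replaces the rest. The obstacle
  is the order of the idempotents, which is known only through \<open>P = Q\<close>. The closing
  equations use the eigenvalues with indices \<open>1\<close>, \<open>N - 1\<close> and
  \<open>N\<close>, so the order must be recovered from \<open>P^2 = n I\<close> before
  \<open>T\<close> can be studied. Counting vectors \<open>v\<close> instead of rank one matrices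
  reduces every count to the range and the kernel of \<open>A\<close> and the values of its form,
  and ranks can be compared through cardinalities. The alternating signs in these counts are the
  reason for using powers of \<open>-q\<close>. The four closing equations are chosen because they
  contain only three unknown ratios of entries of \<open>T\<close>, namely \<open>t 1 / t 0\<close>,
  \<open>t 2 / t 1\<close> and \<open>t (N - 1) / t N\<close>. In the result of the elimination the
  factor \<open>m - B^2\<close> is zero exactly for \<open>N = 2\<close>.\<close>

lemma finite_field_power_CARD:
  fixes x :: "'a::{field,finite}"
  shows "x ^ CARD('a) = x"
proof (cases "x = 0")
  case False
  have bij: "bij_betw ((*) x) (UNIV - {0}) (UNIV - {0})"
    by (rule bij_betwI[of _ _ _ "\<lambda>y. y / x"]) (use False in auto)
  have "(\<Prod>y\<in>UNIV-{0::'a}. y) = (\<Prod>y\<in>UNIV-{0}. x * y)"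
    using prod.reindex_bij_betw[OF bij, of "\<lambda>y. y"] by simp
  also have "\<dots> = x ^ (CARD('a) - 1) * (\<Prod>y\<in>UNIV-{0::'a}. y)"
    by (simp add: prod.distrib)
  finally have "x ^ (CARD('a) - 1) = 1"
    by simp
  then show ?thesis
    using power_Suc[of x "CARD('a) - 1"] finite_UNIV_card_ge_0[where ?'a = 'a] by simp
qed (simp add: power_0_left)

locale quadratic_finite_field =
  fixes q :: nat and ty :: "'a::{field,finite} itself"
  assumes q_primepow: "primepow q" and card_field: "CARD('a) = q ^ 2"
begin

lemma q_gt_1: "q > 1"
  using q_primepow primepow_gt_Suc_0 by auto

text \<open>The characteristic divides \<open>q^2\<close>, so it is the prime of which
  \<open>q\<close> is a power, and \<open>x ^ q\<close> is an iterate of the Frobenius map.\<close>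

lemma frob_add: "(x + y :: 'a) ^ q = x ^ q + y ^ q"
proof -
  have pos: "CHAR('a) > 0"
    by (rule finite_imp_CHAR_pos) simp
  then have pr: "prime CHAR('a)"
    by (rule prime_CHAR_semidom)
  obtain p k where pk: "prime p" "q = p ^ k"
    using q_primepow by (auto simp: primepow_def)
  have "CHAR('a) dvd q ^ 2"
    using CHAR_dvd_CARD[where ?'a = 'a] card_field by simp
  then have "CHAR('a) dvd p"
    using pr pk(2) prime_dvd_power by blast
  then have "p = CHAR('a)"
    using pk(1) pr primes_dvd_imp_eq by metis
  then show ?thesis
    using freshmans_dream'[OF pr, of q k] pk(2) by simp
qed

lemma frob_frob [simp]: "((x::'a) ^ q) ^ q = x"
  using finite_field_power_CARD[of x] card_field by (simp add: power2_eq_square power_mult)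

lemma frob_0 [simp]: "(0::'a) ^ q = 0"
  using q_gt_1 by (simp add: power_0_left)

lemma frob_sum: "(sum f A :: 'a) ^ q = (\<Sum>i\<in>A. f i ^ q)"
  by (induction A rule: infinite_finite_induct) (auto simp: frob_add)

lemma frob_minus: "(- x :: 'a) ^ q = - (x ^ q)"
  using frob_add[of x "- x"] by (simp add: eq_neg_iff_add_eq_0 add.commute)

lemma frob_diff: "(x - y :: 'a) ^ q = x ^ q - y ^ q"
  using frob_add[of x "- y"] by (simp add: frob_minus)

lemma frob_fixed_power: 
  assumes "(c::'a) ^ q = c" "c \<noteq> 0"
  shows "c ^ (q - 1) = 1"
  using assms q_gt_1 power_Suc[of c "q - 1"] by simp

lemma card_power_roots:
  assumes "n > 0"
  shows "card {x::'a. x ^ n = c} \<le> n"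
proof -
  let ?p = "Polynomial.monom 1 n - [:c:]"
  have c: "Polynomial.coeff ?p n = 1"
    using assms by (simp add: coeff_pCons split: nat.splits)
  then have nz: "?p \<noteq> 0"
    by (metis Polynomial.coeff_0 zero_neq_one)
  have "degree ?p \<le> n"
    by (intro degree_diff_le) (simp_all add: degree_monom_le)
  moreover have "{x. x ^ n = c} = {x. poly ?p x = 0}"
    by (simp add: poly_monom)
  ultimately show ?thesis
    using card_poly_roots_bound[OF nz] by simp
qed

text \<open>All estimates are tight: the norm sends the \<open>q^2 - 1\<close> nonzero elements to
  at most \<open>q - 1\<close> values, and each fibre, being a root set, has at most
  \<open>q + 1\<close> elements. A smaller fibre would leave the total too small.\<close>

lemma card_norm_eq:
  assumes "(c::'a) ^ q = c" "c \<noteq> 0"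
  shows "card {x. x * x ^ q = c} = q + 1"
proof -
  let ?K = "{c::'a. c ^ (q - 1) = 1}" and ?f = "\<lambda>x::'a. x * x ^ q"
  have fib: "card {x. ?f x = c} \<le> q + 1" for c
    using card_power_roots[of "q + 1" c] by simp
  have cK: "card ?K \<le> q - 1"
    using card_power_roots[of "q - 1" 1] q_gt_1 by simp
  have K: "c \<in> ?K"
    using assms frob_fixed_power by simp
  have img: "?f x \<in> ?K" if "x \<noteq> 0" for x
    using frob_fixed_power[of "?f x"] that by (simp add: power_mult_distrib mult.commute)
  have K0: "d \<noteq> 0" if "d \<in> ?K" for d
    using that q_gt_1 by (auto simp: power_0_left split: if_splits)
  have "(UNIV :: 'a set) - {0} = (\<Union>d\<in>?K. {x. ?f x = d})"
    using img K0 by force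
  then have "q ^ 2 - 1 = card (\<Union>d\<in>?K. {x. ?f x = d})"
    by (metis card_Diff_singleton card_field UNIV_I)
  also have "\<dots> = (\<Sum>d\<in>?K. card {x. ?f x = d})"
    by (rule card_UN_disjoint) auto
  also have "\<dots> = card {x. ?f x = c} + (\<Sum>d\<in>?K - {c}. card {x. ?f x = d})"
    using K by (intro sum.remove) auto
  also have "\<dots> \<le> card {x. ?f x = c} + (card ?K - 1) * (q + 1)"
    using sum_bounded_above[of "?K - {c}" "\<lambda>d. card {x. ?f x = d}" "q + 1"] fib K
    by (simp add: card_Diff_singleton)
  also have "\<dots> \<le> card {x. ?f x = c} + (q - 2) * (q + 1)"
    using cK by (intro add_left_mono mult_right_mono) auto
  finally have "q ^ 2 - 1 \<le> card {x. ?f x = c} + (q - 2) * (q + 1)" .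
  moreover have "q ^ 2 - 1 = (q + 1) + (q - 2) * (q + 1)"
  proof -
    obtain r where "q = r + 2"
      using q_gt_1 by (metis Suc_1 Suc_leI add.commute le_Suc_ex)
    then show ?thesis
      by (simp add: power2_eq_square algebra_simps)
  qed
  ultimately show ?thesis
    using fib[of c] by linarith
qed

text \<open>The trace \<open>x + x^q\<close> is not identically zero. Otherwise its value at
  \<open>1\<close> gives \<open>1 = -1\<close>, so \<open>x^q = x\<close> for all \<open>x\<close>,
  which is impossible in a field of \<open>q^2\<close> elements. Polarisation of Hermitian forms
  rests on this, also in characteristic two.\<close>

lemma frob_eq_uminus_nontrivial: "\<exists>x::'a. s * x + (s * x) ^ q \<noteq> 0" if "s \<noteq> 0"
proof (rule ccontr)
  assume "\<not> ?thesis"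
  then have all: "s * x + (s * x) ^ q = 0" for x
    by blast
  have u: "y + y ^ q = 0" for y :: 'a
    using all[of "y / s"] that by simp
  have "(1::'a) = - 1"
    using u[of 1] by (simp add: eq_neg_iff_add_eq_0)
  then have "y ^ q = y" for y :: 'a
    using u[of y] by (metis add_eq_0_iff mult_1 mult_minus_left)
  then have "y ^ (q - 1) = 1" if "y \<noteq> 0" for y :: 'a
    using that frob_fixed_power by blast
  then have "UNIV - {0::'a} \<subseteq> {y. y ^ (q - 1) = 1}"
    by blast
  then have "card (UNIV - {0::'a}) \<le> q - 1"
    using card_power_roots[of "q - 1" 1] q_gt_1
    by (meson card_mono finite le_trans zero_less_diff)
  then have "q ^ 2 \<le> q"
    using card_field q_gt_1 by (simp add: card_Diff_singleton)
  then show False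
    using q_gt_1 by (simp add: power2_eq_square)
qed

end

section \<open>Ranks over finite fields\<close>

lemma card_carrier_vec_finite:
  "finite (carrier_vec n :: 'a::finite vec set)"
  "card (carrier_vec n :: 'a vec set) = CARD('a) ^ n"
proof -
  have "bij_betw (\<lambda>v. restrict (vec_index v) {..<n}) (carrier_vec n :: 'a vec set) ({..<n} \<rightarrow>\<^sub>E UNIV)"
    by (rule bij_betwI[of _ _ _ "vec n"]) (auto simp: PiE_def extensional_def fun_eq_iff)
  then show "finite (carrier_vec n :: 'a vec set)" "card (carrier_vec n :: 'a vec set) = CARD('a) ^ n"
    by (simp_all add: bij_betw_finite bij_betw_same_card card_PiE finite_PiE)
qed

text \<open>A maximal independent set \<open>S\<close> of columns spans the column space, and the
  coefficient functions on \<open>S\<close> correspond bijectively to its span. All later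
  comparisons of ranks go through this count.\<close>

lemma card_range_eq_power_rank:
  fixes A :: "'a::{field,finite} mat"
  assumes A: "A \<in> carrier_mat n nc"
  shows "card ((\<lambda>v. A *\<^sub>v v) ` carrier_vec nc) = CARD('a) ^ vec_space.rank n A"
proof -
  interpret vec_space "TYPE('a)" n .
  have cols: "set (cols A) \<subseteq> carrier_vec n"
    using cols_dim A by blast
  obtain S where S: "maximal S (\<lambda>T. T \<subseteq> set (cols A) \<and> lin_indpt T)"
    using maximal_exists[of "\<lambda>T. T \<subseteq> set (cols A) \<and> lin_indpt T" "card (set (cols A))" "{}"]
    by (meson List.finite_set card_mono empty_iff empty_subsetI finite_lin_indpt2 rev_finite_subset)
  have Sc: "S \<subseteq> set (cols A)" and ind: "lin_indpt S"
    using S by (auto simp: maximal_def)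
  have fin: "finite S" and SV: "S \<subseteq> carrier_vec n"
    using Sc cols finite_subset by blast+
  have "s \<in> span S" if "s \<in> set (cols A)" for s
  proof (cases "s \<in> S")
    case True
    then show ?thesis
      using span_mem SV by blast
  next
    case False
    have "lin_dep (S \<union> {s})"
      using S False that unfolding maximal_def by (metis Un_insert_right Un_upper1 insertI1 insert_subset sup_bot.right_neutral)
    moreover have "s \<in> carrier_vec n"
      using cols that by blast
    ultimately show ?thesis
      using lin_dep_iff_in_span[of S s] SV ind False by simp
  qed
  then have span: "span S = span (set (cols A))"
    by (intro equalityI span_is_monotone[OF Sc] span_subsetI[OF SV] subsetI)
  have idx: "lincomb a S $ i = (\<Sum>x\<in>S. a x * x $ i)" if "i < n" for a i
    using lincomb_index[OF that SV] by simp
  have "inj_on (\<lambda>a. lincomb a S) (S \<rightarrow>\<^sub>E UNIV)"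
  proof (rule inj_onI)
    fix a b assume ab: "a \<in> S \<rightarrow>\<^sub>E UNIV" "b \<in> S \<rightarrow>\<^sub>E UNIV" "lincomb a S = lincomb b S"
    have "lincomb (\<lambda>x. a x - b x) S = 0\<^sub>v n"
    proof (rule eq_vecI)
      fix i assume "i < dim_vec (0\<^sub>v n :: 'a vec)"
      then show "lincomb (\<lambda>x. a x - b x) S $ i = 0\<^sub>v n $ i"
        using idx[of i a] idx[of i b] idx[of i "\<lambda>x. a x - b x"] ab(3)
        by (simp add: left_diff_distrib sum_subtractf)
    qed (use SV in \<open>simp add: lincomb_dim[OF fin]\<close>)
    then have "\<forall>x\<in>S. a x - b x = 0"
      using ind fin SV not_lindepD[OF ind fin subset_refl, of "\<lambda>x. a x - b x"] by auto
    then show "a = b"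
      using ab(1,2) by (intro PiE_ext[of a S "\<lambda>_. UNIV" b]) auto
  qed
  moreover have "(\<lambda>a. lincomb a S) ` (S \<rightarrow>\<^sub>E UNIV) = span S"
  proof -
    have "lincomb a S \<in> (\<lambda>a. lincomb a S) ` (S \<rightarrow>\<^sub>E UNIV)" for a
    proof (rule image_eqI)
      show "lincomb a S = lincomb (restrict a S) S"
        using SV by (intro lincomb_cong) auto
    qed simp
    then show ?thesis
      using finite_span[OF fin] SV by auto
  qed
  ultimately have "card (span S) = CARD('a) ^ card S"
    using card_image[of "\<lambda>a. lincomb a S" "S \<rightarrow>\<^sub>E UNIV"] card_PiE[OF fin, of "\<lambda>_. UNIV :: 'a set"] by simp
  moreover have "rank A = card S"
    using rank_card_indpt[OF A S] .
  moreover have "(\<lambda>v. A *\<^sub>v v) ` carrier_vec nc = span (set (cols A))"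
    using col_space_eq[OF A] A by (auto simp: col_space_def)
  ultimately show ?thesis
    using span by simp
qed

section \<open>Hermitian matrices\<close>

locale hermitian_geometry = quadratic_finite_field q ty
  for q :: nat and ty :: "'a::{field,finite} itself" +
  fixes N :: nat
begin

abbreviation V :: "'a vec set" where "V \<equiv> carrier_vec N"

abbreviation H :: "'a mat set" where "H \<equiv> hermitian_forms q N"

definition hdot :: "'a vec \<Rightarrow> 'a vec \<Rightarrow> 'a" where
  "hdot u v = (\<Sum>i<N. (u $ i) ^ q * v $ i)"

definition outer :: "'a vec \<Rightarrow> 'a mat" where
  "outer u = mat N N (\<lambda>(i, j). u $ i * (u $ j) ^ q)"

definition ker :: "'a mat \<Rightarrow> 'a vec set" where
  "ker A = {v \<in> V. A *\<^sub>v v = 0\<^sub>v N}"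

abbreviation form :: "'a mat \<Rightarrow> 'a vec \<Rightarrow> 'a" where
  "form A v \<equiv> hdot v (A *\<^sub>v v)"

abbreviation rk :: "'a mat \<Rightarrow> nat" where
  "rk A \<equiv> vec_space.rank N A"

lemma finite_V [simp]: "finite V" and card_V: "card V = q ^ (2 * N)"
  using card_carrier_vec_finite[of N, where ?'a = 'a] by (simp_all add: card_field power_mult)

lemma hdot_frob: "(hdot u v) ^ q = hdot v u"
  by (simp add: hdot_def frob_sum power_mult_distrib mult.commute)

lemma hdot_add_right: "v \<in> V \<Longrightarrow> w \<in> V \<Longrightarrow> hdot u (v + w) = hdot u v + hdot u w"
  by (simp add: hdot_def algebra_simps sum.distrib)

lemma hdot_smult_right: "v \<in> V \<Longrightarrow> hdot u (c \<cdot>\<^sub>v v) = c * hdot u v"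
  by (simp add: hdot_def algebra_simps sum_distrib_left)

lemma hdot_add_left: "v \<in> V \<Longrightarrow> w \<in> V \<Longrightarrow> hdot (v + w) u = hdot v u + hdot w u"
  by (simp add: hdot_def algebra_simps sum.distrib frob_add)

lemma hdot_smult_left: "v \<in> V \<Longrightarrow> hdot (c \<cdot>\<^sub>v v) u = c ^ q * hdot v u"
  by (simp add: hdot_def algebra_simps sum_distrib_left power_mult_distrib)

lemma hdot_minus_left: "v \<in> V \<Longrightarrow> w \<in> V \<Longrightarrow> hdot (v - w) u = hdot v u - hdot w u"
  by (simp add: hdot_def algebra_simps sum_subtractf frob_diff)

lemma hdot_minus_right: "v \<in> V \<Longrightarrow> w \<in> V \<Longrightarrow> hdot u (v - w) = hdot u v - hdot u w"
  by (simp add: hdot_def algebra_simps sum_subtractf)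

lemma hdot_zero [simp]: "hdot u (0\<^sub>v N) = 0" "hdot (0\<^sub>v N) u = 0"
  by (simp_all add: hdot_def)

lemma hdot_unit: "i < N \<Longrightarrow> v \<in> V \<Longrightarrow> hdot (unit_vec N i) v = v $ i"
  by (simp add: hdot_def unit_vec_def if_distrib[of "\<lambda>x. x ^ q"] if_distrib[of "\<lambda>x. x * _"] 
      cong: if_cong)

lemma hdot_nondegenerate: 
  assumes "v \<in> V" "\<And>x. x \<in> V \<Longrightarrow> hdot x v = 0"
  shows "v = 0\<^sub>v N"
  using assms hdot_unit[OF _ assms(1)] by (intro eq_vecI) auto

lemma H_carrier: "A \<in> H \<Longrightarrow> A \<in> carrier_mat N N"
  by (simp add: hermitian_forms_def)

lemma H_entry: "A \<in> H \<Longrightarrow> i < N \<Longrightarrow> j < N \<Longrightarrow> (A $$ (j, i)) ^ q = A $$ (i, j)"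
  unfolding hermitian_forms_def
  by (smt (verit) carrier_matD index_map_mat(1) index_transpose_mat mem_Collect_eq)

lemma HI: "A \<in> carrier_mat N N \<Longrightarrow> (\<And>i j. i < N \<Longrightarrow> j < N \<Longrightarrow> (A $$ (j, i)) ^ q = A $$ (i, j)) \<Longrightarrow> A \<in> H"
  unfolding hermitian_forms_def by (auto intro!: eq_matI)

lemma H_minus: "A \<in> H \<Longrightarrow> B \<in> H \<Longrightarrow> A - B \<in> H"
  using H_carrier[of A] H_carrier[of B] by (intro HI) (auto simp: H_entry frob_diff)

lemma H_zero: "0\<^sub>m N N \<in> H"
  by (rule HI) auto

lemma outer_H: "outer u \<in> H"
  by (rule HI) (auto simp: outer_def power_mult_distrib)

lemma outer_carrier [simp]: "outer u \<in> carrier_mat N N"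
  by (simp add: outer_def)

lemma mult_mat_vec_entry:
  "A \<in> carrier_mat N N \<Longrightarrow> v \<in> V \<Longrightarrow> i < N \<Longrightarrow> (A *\<^sub>v v) $ i = (\<Sum>j<N. A $$ (i, j) * v $ j)"
  by (auto simp: scalar_prod_def atLeast0LessThan)

lemma outer_mult: "u \<in> V \<Longrightarrow> x \<in> V \<Longrightarrow> outer u *\<^sub>v x = hdot u x \<cdot>\<^sub>v u"
  by (rule eq_vecI)
    (auto simp: mult_mat_vec_entry outer_def hdot_def sum_distrib_left sum_distrib_right algebra_simps
      simp del: index_mult_mat_vec)

lemma hdot_adjoint:
  assumes A: "A \<in> H" and uv: "u \<in> V" "v \<in> V"
  shows "hdot u (A *\<^sub>v v) = hdot (A *\<^sub>v u) v"
proof -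
  note [simp del] = index_mult_mat_vec
  have "hdot u (A *\<^sub>v v) = (\<Sum>i<N. \<Sum>j<N. A $$ (i, j) * (u $ i) ^ q * v $ j)"
    by (simp add: hdot_def mult_mat_vec_entry[OF H_carrier[OF A]] uv sum_distrib_left algebra_simps)
  also have "\<dots> = (\<Sum>j<N. \<Sum>i<N. A $$ (i, j) * (u $ i) ^ q * v $ j)"
    by (rule sum.swap)
  also have "\<dots> = hdot (A *\<^sub>v u) v"
    by (simp add: hdot_def mult_mat_vec_entry[OF H_carrier[OF A]] uv sum_distrib_right frob_sum
      power_mult_distrib H_entry[OF A])
  finally show ?thesis .
qed

lemma mult_V [simp]: "A \<in> H \<Longrightarrow> v \<in> V \<Longrightarrow> A *\<^sub>v v \<in> V"
  using H_carrier mult_mat_vec_carrier by blast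

lemma H_linear:
  assumes "A \<in> H" "v \<in> V" "w \<in> V"
  shows "A *\<^sub>v (v + w) = A *\<^sub>v v + A *\<^sub>v w" "A *\<^sub>v (v - w) = A *\<^sub>v v - A *\<^sub>v w"
    "A *\<^sub>v (c \<cdot>\<^sub>v v) = c \<cdot>\<^sub>v (A *\<^sub>v v)"
  using assms H_carrier[OF assms(1)] by (simp_all add: mult_add_distrib_mat_vec mult_minus_distrib_mat_vec
      mult_mat_vec)

lemma minus_outer_mult: 
  "A \<in> H \<Longrightarrow> u \<in> V \<Longrightarrow> x \<in> V \<Longrightarrow> (A - outer u) *\<^sub>v x = A *\<^sub>v x - hdot u x \<cdot>\<^sub>v u"
  using H_carrier[of A] by (simp add: minus_mult_distrib_mat_vec outer_mult)

section \<open>Kernels, and ranks read off from their size\<close>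

lemma ker_V: "x \<in> ker A \<Longrightarrow> x \<in> V" and kerD: "x \<in> ker A \<Longrightarrow> A *\<^sub>v x = 0\<^sub>v N"
  by (simp_all add: ker_def)

lemma finite_ker [simp]: "finite (ker A)"
  by (rule finite_subset[OF _ finite_V]) (auto simp: ker_def)

lemma zero_ker: "A \<in> H \<Longrightarrow> 0\<^sub>v N \<in> ker A"
  using H_carrier[of A] by (auto simp: ker_def intro!: eq_vecI)

lemma ker_add: "A \<in> H \<Longrightarrow> x \<in> ker A \<Longrightarrow> y \<in> ker A \<Longrightarrow> x + y \<in> ker A"
  by (simp add: ker_def H_linear)

lemma ker_smult: "A \<in> H \<Longrightarrow> x \<in> ker A \<Longrightarrow> c \<cdot>\<^sub>v x \<in> ker A"
  by (auto simp: ker_def H_linear intro!: eq_vecI)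

text \<open>Subtracting \<open>hdot u x\<close> times \<open>w\<close> from \<open>x\<close>
  projects onto the hyperplane \<open>hdot u y = 0\<close> along \<open>w\<close>. \<open>W\<close>
  is any set closed under sums and multiples, because both the whole space and kernels are split
  this way.\<close>

lemma bij_betw_hyperplane:
  assumes W: "W \<subseteq> V" "\<And>x y. x \<in> W \<Longrightarrow> y \<in> W \<Longrightarrow> x + y \<in> W" "\<And>c x. x \<in> W \<Longrightarrow> c \<cdot>\<^sub>v x \<in> W"
    and w: "w \<in> W" "hdot u w = 1"
  shows "bij_betw (\<lambda>(y, s). y + s \<cdot>\<^sub>v w) ({y \<in> W. hdot u y = 0} \<times> UNIV) W"
proof (rule bij_betwI[of _ _ _ "\<lambda>x. (x + (- hdot u x) \<cdot>\<^sub>v w, hdot u x)"])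
  have WV: "x \<in> V" if "x \<in> W" for x
    using W that by blast
  show "(\<lambda>(y, s). y + s \<cdot>\<^sub>v w) \<in> {y \<in> W. hdot u y = 0} \<times> UNIV \<rightarrow> W"
    using W w by auto
  show "(\<lambda>x. (x + (- hdot u x) \<cdot>\<^sub>v w, hdot u x)) \<in> W \<rightarrow> {y \<in> W. hdot u y = 0} \<times> UNIV"
    using W w WV by (auto simp: hdot_add_right hdot_smult_right)
  show "(case (x + (- hdot u x) \<cdot>\<^sub>v w, hdot u x) of (y, s) \<Rightarrow> y + s \<cdot>\<^sub>v w) = x" if "x \<in> W" for x
    using WV[OF that] WV[OF w(1)] by (auto intro!: eq_vecI)
  show "(\<lambda>x. (x + (- hdot u x) \<cdot>\<^sub>v w, hdot u x)) (case p of (y, s) \<Rightarrow> y + s \<cdot>\<^sub>v w) = p"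
    if mem: "p \<in> {y \<in> W. hdot u y = 0} \<times> UNIV" for p
  proof -
    obtain y s where p: "p = (y, s)" "y \<in> W" "hdot u y = 0"
      using mem by blast
    have "hdot u (y + s \<cdot>\<^sub>v w) = s"
      using p WV w by (simp add: hdot_add_right hdot_smult_right)
    moreover have "y + s \<cdot>\<^sub>v w + (- s) \<cdot>\<^sub>v w = y"
      using WV[OF p(2)] WV[OF w(1)] by (intro eq_vecI) auto
    ultimately show ?thesis
      using p(1) by simp
  qed
qed

lemma card_hyperplane:
  assumes "W \<subseteq> V" "\<And>x y. x \<in> W \<Longrightarrow> y \<in> W \<Longrightarrow> x + y \<in> W" "\<And>c x. x \<in> W \<Longrightarrow> c \<cdot>\<^sub>v x \<in> W"
    and "w \<in> W" "hdot u w = 1"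
  shows "card W = q ^ 2 * card {y \<in> W. hdot u y = 0}"
  using bij_betw_same_card[OF bij_betw_hyperplane[OF assms]] card_field
  by (simp add: card_cartesian_product mult.commute)

text \<open>\<open>S\<close> is a union of cosets of \<open>ker A\<close>, and these cosets are the
  fibres of \<open>A\<close> on \<open>S\<close>.\<close>

lemma card_fibres:
  assumes A: "A \<in> H" and S: "S \<subseteq> V" "\<And>x z. x \<in> S \<Longrightarrow> z \<in> ker A \<Longrightarrow> x + z \<in> S"
  shows "card S = card (ker A) * card ((\<lambda>x. A *\<^sub>v x) ` S)"
proof -
  have fin: "finite S"
    using S(1) finite_subset finite_V by blast
  have "card {x \<in> S. A *\<^sub>v x = y} = card (ker A)" if y: "y \<in> (\<lambda>x. A *\<^sub>v x) ` S" for y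
  proof -
    obtain x where x: "x \<in> S" "y = A *\<^sub>v x"
      using y by blast
    then have xV: "x \<in> V"
      using S by blast
    have "bij_betw (\<lambda>z. x + z) (ker A) {x \<in> S. A *\<^sub>v x = y}"
    proof (rule bij_betwI[of _ _ _ "\<lambda>z. z - x"])
      show "(\<lambda>z. x + z) \<in> ker A \<rightarrow> {x \<in> S. A *\<^sub>v x = y}"
        using S(2)[OF x(1)] xV A by (auto simp: x(2) H_linear ker_V kerD)
      show "(\<lambda>z. z - x) \<in> {x \<in> S. A *\<^sub>v x = y} \<rightarrow> ker A"
        using S(1) xV A x(2) by (auto simp: ker_def H_linear subset_iff)
    qed (use xV S(1) ker_V in \<open>auto intro!: eq_vecI simp: subset_iff\<close>, fastforce+)
    then show ?thesis
      using bij_betw_same_card by metis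
  qed
  then have "(\<Sum>y\<in>(\<lambda>x. A *\<^sub>v x) ` S. card {x \<in> S. A *\<^sub>v x = y}) = card (ker A) * card ((\<lambda>x. A *\<^sub>v x) ` S)"
    by simp
  moreover have "card S = (\<Sum>y\<in>(\<lambda>x. A *\<^sub>v x) ` S. card {x \<in> S. A *\<^sub>v x = y})"
    using sum.image_gen[OF fin, of "\<lambda>_. 1::nat" "\<lambda>x. A *\<^sub>v x"] by simp
  ultimately show ?thesis
    by simp
qed

lemma card_range_rk: "A \<in> H \<Longrightarrow> card ((\<lambda>x. A *\<^sub>v x) ` V) = q ^ (2 * rk A)"
  using card_range_eq_power_rank[OF H_carrier, of A] by (simp add: card_field power_mult)

lemma card_ker_rk:
  assumes "A \<in> H"
  shows "card (ker A) * q ^ (2 * rk A) = q ^ (2 * N)"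
  using card_fibres[OF assms, of V] card_V card_range_rk[OF assms] ker_V by simp

text \<open>One dimension of the kernel is worth a factor \<open>q^2\<close>. Both sides are kept
  additive, so that no truncated difference of ranks appears.\<close>

lemma rk_eq_iff_card_ker:
  assumes "A \<in> H" "B \<in> H"
  shows "q ^ (2 * i) * card (ker A) = q ^ (2 * j) * card (ker B) \<longleftrightarrow> rk A + j = rk B + i"
proof -
  have pos: "card (ker A) > 0" "card (ker B) > 0"
    using card_ker_rk assms q_gt_1 by (metis gr0I mult_eq_0_iff power_not_zero not_one_less_zero)+
  have "q ^ (2 * i) * card (ker A) = q ^ (2 * j) * card (ker B) \<longleftrightarrow> 
    q ^ (2 * i) * card (ker A) * q ^ (2 * (rk A + rk B)) = q ^ (2 * j) * card (ker B) * q ^ (2 * (rk A + rk B))"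
    using q_gt_1 by simp
  also have "q ^ (2 * i) * card (ker A) * q ^ (2 * (rk A + rk B)) = q ^ (2 * (i + rk B)) * (card (ker A) * q ^ (2 * rk A))"
    by (simp add: power_add distrib_left)
  also have "q ^ (2 * j) * card (ker B) * q ^ (2 * (rk A + rk B)) = q ^ (2 * (j + rk A)) * (card (ker B) * q ^ (2 * rk B))"
    by (simp add: power_add distrib_left)
  also have "q ^ (2 * (i + rk B)) * (card (ker A) * q ^ (2 * rk A)) = q ^ (2 * (j + rk A)) * (card (ker B) * q ^ (2 * rk B)) \<longleftrightarrow>
    q ^ (2 * (i + rk B)) = q ^ (2 * (j + rk A))"
    using q_gt_1 by (simp add: card_ker_rk assms)
  also have "\<dots> \<longleftrightarrow> rk A + j = rk B + i"
    using q_gt_1 power_inject_exp[of q "2 * (i + rk B)" "2 * (j + rk A)"] by auto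
  finally show ?thesis .
qed

text \<open>If the form vanished everywhere, its expansion at \<open>x + c y\<close> would make the
  trace of \<open>c * hdot x (A y)\<close> zero for all \<open>c\<close>, and \<open>A\<close> would
  be zero. A nonzero value is fixed by \<open>x^q\<close>, so surjectivity of the norm allows it to
  be scaled to \<open>1\<close>.\<close>

lemma exists_form_eq_1:
  assumes A: "A \<in> H" and nz: "A \<noteq> 0\<^sub>m N N"
  shows "\<exists>w\<in>V. form A w = 1"
proof -
  have "\<exists>w\<in>V. form A w \<noteq> 0"
  proof (rule ccontr)
    assume "\<not> ?thesis"
    then have iso: "form A w = 0" if "w \<in> V" for w
      using that by blast
    have z: "hdot x (A *\<^sub>v y) = 0" if xy: "x \<in> V" "y \<in> V" for x y
    proof (rule ccontr)
      assume "hdot x (A *\<^sub>v y) \<noteq> 0"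
      then obtain c where c: "hdot x (A *\<^sub>v y) * c + (hdot x (A *\<^sub>v y) * c) ^ q \<noteq> 0"
        using frob_eq_uminus_nontrivial by blast
      have "form A (x + c \<cdot>\<^sub>v y) = 0"
        using iso xy by simp
      moreover have "form A (x + c \<cdot>\<^sub>v y) = c * hdot x (A *\<^sub>v y) + c ^ q * hdot y (A *\<^sub>v x)"
        using iso[OF xy(1)] iso[OF xy(2)] xy A
        by (simp add: H_linear hdot_add_left hdot_add_right hdot_smult_left hdot_smult_right)
      moreover have "hdot y (A *\<^sub>v x) = (hdot x (A *\<^sub>v y)) ^ q"
        using hdot_adjoint[OF A xy] by (simp add: hdot_frob)
      ultimately show False
        using c by (simp add: power_mult_distrib mult.commute)
    qed
    have Az: "A *\<^sub>v y = 0\<^sub>v N" if "y \<in> V" for y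
      using hdot_nondegenerate[of "A *\<^sub>v y"] z that A by simp
    have "A = 0\<^sub>m N N"
    proof (rule eq_matI)
      fix i j assume ij: "i < dim_row (0\<^sub>m N N :: 'a mat)" "j < dim_col (0\<^sub>m N N :: 'a mat)"
      have "A $$ (i, j) = (A *\<^sub>v unit_vec N j) $ i"
        using ij H_carrier[OF A] by (simp add: scalar_prod_right_unit[of j N])
      also have "A *\<^sub>v unit_vec N j = 0\<^sub>v N"
        using Az ij by simp
      finally show "A $$ (i, j) = 0\<^sub>m N N $$ (i, j)"
        using ij by simp
    qed (use H_carrier[OF A] in auto)
    then show False
      using nz by simp
  qed
  then obtain w where w: "w \<in> V" "form A w \<noteq> 0"
    by blast
  let ?h = "form A w"
  have h: "?h ^ q = ?h"
    using w A by (simp add: hdot_frob hdot_adjoint)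
  have "card {x. x * x ^ q = inverse ?h} = q + 1"
    using w h by (intro card_norm_eq) (simp_all add: power_inverse)
  then obtain c where c: "c * c ^ q = inverse ?h"
    by (metis (mono_tags, lifting) Collect_empty_eq card.empty add_is_0 one_neq_zero)
  have "form A (c \<cdot>\<^sub>v w) = c * c ^ q * ?h"
    using w A by (simp add: H_linear hdot_smult_left hdot_smult_right)
  then have "form A (c \<cdot>\<^sub>v w) = 1"
    using c w by simp
  then show ?thesis
    using w by (metis smult_carrier_vec)
qed

section \<open>Effect of subtracting a rank one form\<close>

lemma bij_betw_pairE:
  assumes "bij_betw (\<lambda>(y, s). f y s) (U \<times> UNIV) W" "x \<in> W"
  obtains y s where "y \<in> U" "x = f y s"
  using assms by (auto simp: bij_betw_def)

text \<open>The new kernel is \<open>ker A\<close> plus the line through \<open>w\<close>: both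
  matrices agree on the hyperplane \<open>hdot u y = 0\<close>, which contains \<open>ker A\<close>
  because \<open>hdot u y = hdot w (A y)\<close>, and \<open>w\<close> is transversal to it.\<close>

lemma ker_minus_outer:
  assumes A: "A \<in> H" and w: "w \<in> V" "form A w = 1"
  defines "u \<equiv> A *\<^sub>v w"
  shows "w \<in> ker (A - outer u)" "hdot u w = 1" "{y \<in> ker (A - outer u). hdot u y = 0} = ker A"
proof -
  have u: "u \<in> V"
    using A w by (simp add: u_def)
  show hu: "hdot u w = 1"
    using w hdot_adjoint[OF A w(1) w(1)] by (simp add: u_def)
  show "w \<in> ker (A - outer u)"
    using w u A by (auto simp: ker_def minus_outer_mult hu) (simp add: u_def)
  have z: "hdot u y = 0" if "y \<in> ker A" for y
    using hdot_adjoint[OF A w(1) ker_V[OF that]] kerD[OF that] by (simp add: u_def)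
  have zu: "0 \<cdot>\<^sub>v u = 0\<^sub>v N"
    using u by (intro eq_vecI) auto
  show "{y \<in> ker (A - outer u). hdot u y = 0} = ker A"
    using z u A by (auto simp: ker_def minus_outer_mult zu)
qed

lemma ker_subset: "ker A \<subseteq> V"
  by (auto simp: ker_def)

lemma minus_outer_H: "A \<in> H \<Longrightarrow> A - outer u \<in> H"
  by (simp add: H_minus outer_H)

lemma card_ker_minus_outer:
  assumes A: "A \<in> H" and w: "w \<in> V" "form A w = 1"
  shows "card (ker (A - outer (A *\<^sub>v w))) = q ^ 2 * card (ker A)"
  using card_hyperplane[of "ker (A - outer (A *\<^sub>v w))" w "A *\<^sub>v w"] ker_minus_outer[OF assms]
    ker_add[OF minus_outer_H[OF A]] ker_smult[OF minus_outer_H[OF A]] ker_subset by auto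

lemma rk_minus_outer:
  assumes "A \<in> H" "w \<in> V" "form A w = 1"
  shows "rk A = Suc (rk (A - outer (A *\<^sub>v w)))"
  using card_ker_minus_outer[OF assms] rk_eq_iff_card_ker[of A "A - outer (A *\<^sub>v w)" 1 0] assms(1)
  by (simp add: minus_outer_H)

text \<open>Diagonalisation of Hermitian forms as an induction principle: a vector of form value
  \<open>1\<close> splits off a rank one summand and lowers the rank by one.\<close>

lemma hermitian_induct [consumes 1, case_names zero reduce]:
  assumes "A \<in> H" "P (0\<^sub>m N N)"
    and "\<And>A w. A \<in> H \<Longrightarrow> w \<in> V \<Longrightarrow> form A w = 1 \<Longrightarrow> P (A - outer (A *\<^sub>v w)) \<Longrightarrow> P A"
  shows "P A"
  using assms(1)
proof (induction "rk A" arbitrary: A rule: less_induct)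
  case less
  show ?case
  proof (cases "A = 0\<^sub>m N N")
    case False
    then obtain w where w: "w \<in> V" "form A w = 1"
      using exists_form_eq_1 less.prems by blast
    then show ?thesis
      using assms(3) less rk_minus_outer minus_outer_H by (metis lessI)
  qed (use assms in simp)
qed

text \<open>The range is the orthogonal complement of the kernel. In the induction step the smaller
  matrix has \<open>w\<close> as an additional kernel vector, so \<open>v\<close> is first corrected
  by a multiple of \<open>u\<close> to become orthogonal to \<open>w\<close> as well.\<close>

lemma in_range_if_orthogonal_ker:
  assumes "A \<in> H" "v \<in> V" "\<And>x. x \<in> ker A \<Longrightarrow> hdot v x = 0"
  shows "\<exists>y\<in>V. v = A *\<^sub>v y"
  using assms
proof (induction A arbitrary: v rule: hermitian_induct)
  case zero
  have "x \<in> ker (0\<^sub>m N N)" if "x \<in> V" for x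
    using that by (auto simp: ker_def intro!: eq_vecI)
  then have "hdot v x = 0" if "x \<in> V" for x
    using zero that by blast
  then have "hdot x v = 0" if "x \<in> V" for x
    using that hdot_frob[of v x] by simp
  then have "v = 0\<^sub>v N"
    using hdot_nondegenerate[OF zero(1)] by blast
  then show ?case
    by (intro bexI[of _ "0\<^sub>v N"]) (auto intro!: eq_vecI)
next
  case (reduce A w)
  define u where "u = A *\<^sub>v w"
  \<comment> \<open>The left argument of \<open>hdot\<close> is conjugate linear, hence the
    conjugate of \<open>hdot v w\<close>; since \<open>hdot u w = 1\<close>, this makes
    \<open>v - \<beta> u\<close> orthogonal to \<open>w\<close>.\<close>
  define \<beta> where "\<beta> = (hdot v w) ^ q"
  define B where "B = A - outer u"
  have u: "u \<in> V"
    using reduce by (simp add: u_def)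
  have B: "B \<in> H"
    using reduce by (simp add: B_def minus_outer_H)
  note ker = ker_minus_outer[OF reduce(1-3), folded u_def, folded B_def]
  have "hdot (v - \<beta> \<cdot>\<^sub>v u) x = 0" if x: "x \<in> ker B" for x
  proof -
    have bij: "bij_betw (\<lambda>(y, s). y + s \<cdot>\<^sub>v w) (ker A \<times> UNIV) (ker B)"
      using bij_betw_hyperplane[of "ker B" w u] ker ker_add[OF B] ker_smult[OF B] ker_subset by auto
    obtain y s where y: "y \<in> ker A" "x = y + s \<cdot>\<^sub>v w"
      using bij_betw_pairE[OF bij x] by auto
    have yV: "y \<in> V" and uy: "hdot u y = 0"
      using y ker_V ker(3) by auto
    show ?thesis
      using yV uy u reduce(2) reduce.prems(1) reduce.prems(2)[OF y(1)] ker(2)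
      by (simp add: y(2) hdot_add_right hdot_smult_right hdot_minus_left hdot_smult_left \<beta>_def)
  qed
  then obtain y where y: "y \<in> V" "v - \<beta> \<cdot>\<^sub>v u = B *\<^sub>v y"
    using reduce.IH[folded u_def, folded B_def, of "v - \<beta> \<cdot>\<^sub>v u"] reduce.prems(1) u by auto
  have Ay: "A *\<^sub>v y \<in> V"
    using reduce(1) y by simp
  have eq: "v - \<beta> \<cdot>\<^sub>v u = A *\<^sub>v y - hdot u y \<cdot>\<^sub>v u"
    using y u reduce(1) by (simp add: B_def minus_outer_mult)
  have "v = A *\<^sub>v y + (\<beta> - hdot u y) \<cdot>\<^sub>v u"
  proof (rule eq_vecI)
    fix i assume "i < dim_vec (A *\<^sub>v y + (\<beta> - hdot u y) \<cdot>\<^sub>v u)"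
    then have i: "i < N"
      using u by simp
    then have "(v - \<beta> \<cdot>\<^sub>v u) $ i = (A *\<^sub>v y - hdot u y \<cdot>\<^sub>v u) $ i"
      using eq by simp
    then show "v $ i = (A *\<^sub>v y + (\<beta> - hdot u y) \<cdot>\<^sub>v u) $ i"
      using i u Ay reduce.prems(1)
      by (simp add: algebra_simps del: index_mult_mat_vec)
  qed (use u Ay reduce.prems(1) in simp)
  also have "\<dots> = A *\<^sub>v (y + (\<beta> - hdot u y) \<cdot>\<^sub>v w)"
    using reduce(1,2) y by (simp add: H_linear u_def)
  finally show ?case
    using y reduce(2) by (intro bexI[of _ "y + (\<beta> - hdot u y) \<cdot>\<^sub>v w"]) auto
qed

text \<open>A vector \<open>z\<close> in the new kernel satisfies \<open>A z = hdot v z v\<close>,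
  and both sides vanish as \<open>v\<close> is outside the range. So the kernel shrinks to a
  hyperplane of \<open>ker A\<close>, a proper one because \<open>v\<close> is not orthogonal to
  \<open>ker A\<close>.\<close>

lemma rk_minus_outer_notin_range:
  assumes A: "A \<in> H" and v: "v \<in> V" "v \<notin> (\<lambda>x. A *\<^sub>v x) ` V"
  shows "rk (A - outer v) = Suc (rk A)"
proof -
  obtain x where x: "x \<in> ker A" "hdot v x \<noteq> 0"
    using in_range_if_orthogonal_ker[OF A v(1)] v(2) by blast
  then have xV: "x \<in> V"
    using ker_V by blast
  define y where "y = inverse (hdot v x) \<cdot>\<^sub>v x"
  have y: "y \<in> ker A" "hdot v y = 1"
    using x A xV by (simp_all add: y_def ker_smult hdot_smult_right)
  have "ker (A - outer v) = {y \<in> ker A. hdot v y = 0}"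
  proof (intro equalityI subsetI)
    fix z assume z: "z \<in> ker (A - outer v)"
    then have zV: "z \<in> V"
      using ker_V by blast
    have Az: "A *\<^sub>v z \<in> V"
      using A zV by simp
    have eq: "A *\<^sub>v z - hdot v z \<cdot>\<^sub>v v = 0\<^sub>v N"
      using kerD[OF z] A v zV by (simp add: minus_outer_mult)
    have entry: "(A *\<^sub>v z) $ i = hdot v z * v $ i" if "i < N" for i
    proof -
      have "(A *\<^sub>v z - hdot v z \<cdot>\<^sub>v v) $ i = 0\<^sub>v N $ i"
        unfolding eq ..
      then show ?thesis
        using that v Az by (simp del: index_mult_mat_vec)
    qed
    have "hdot v z = 0"
    proof (rule ccontr)
      assume nz: "hdot v z \<noteq> 0"
      have "v = inverse (hdot v z) \<cdot>\<^sub>v (A *\<^sub>v z)"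
        using nz entry v Az carrier_matD[OF H_carrier[OF A]]
        by (intro eq_vecI) (simp_all del: index_mult_mat_vec)
      also have "\<dots> = A *\<^sub>v (inverse (hdot v z) \<cdot>\<^sub>v z)"
        using A zV by (simp add: H_linear)
      finally have "v \<in> (\<lambda>x. A *\<^sub>v x) ` V"
        using zV by (intro image_eqI[of _ _ "inverse (hdot v z) \<cdot>\<^sub>v z"]) auto
      then show False
        using v(2) by simp
    qed
    moreover have "A *\<^sub>v z = 0\<^sub>v N"
      using entry calculation Az carrier_matD[OF H_carrier[OF A]]
      by (intro eq_vecI) (simp_all del: index_mult_mat_vec)
    ultimately show "z \<in> {y \<in> ker A. hdot v y = 0}"
      using zV by (simp add: ker_def)
  next
    fix z assume z: "z \<in> {y \<in> ker A. hdot v y = 0}"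
    have zu: "0 \<cdot>\<^sub>v v = 0\<^sub>v N"
      using v by (intro eq_vecI) auto
    show "z \<in> ker (A - outer v)"
      using z A v by (simp add: ker_def minus_outer_mult zu)
  qed
  then have "card (ker A) = q ^ 2 * card (ker (A - outer v))"
    using card_hyperplane[of "ker A" y v] y A ker_subset ker_add ker_smult by auto
  then show ?thesis
    using rk_eq_iff_card_ker[OF A minus_outer_H[OF A], of 0 1 v] by simp
qed

text \<open>Pairing \<open>A z = hdot u z u\<close> with \<open>w\<close> gives
  \<open>hdot u z * (1 - form A w) = 0\<close>, so no new kernel vectors appear.\<close>

lemma rk_minus_outer_other:
  assumes A: "A \<in> H" and w: "w \<in> V" "form A w \<noteq> 1"
  shows "rk (A - outer (A *\<^sub>v w)) = rk A"
proof -
  define u where "u = A *\<^sub>v w"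
  have u: "u \<in> V"
    using A w by (simp add: u_def)
  have zu: "0 \<cdot>\<^sub>v u = 0\<^sub>v N"
    using u by (intro eq_vecI) auto
  have "ker (A - outer u) = ker A"
  proof (intro equalityI subsetI)
    fix z assume z: "z \<in> ker (A - outer u)"
    then have zV: "z \<in> V"
      using ker_V by blast
    have eq: "A *\<^sub>v z - hdot u z \<cdot>\<^sub>v u = 0\<^sub>v N"
      using kerD[OF z] A u zV by (simp add: minus_outer_mult)
    have "hdot u z = hdot w (A *\<^sub>v z)"
      using hdot_adjoint[OF A w(1) zV] by (simp add: u_def)
    moreover have "hdot w (A *\<^sub>v z) - hdot u z * hdot w u = 0"
      using arg_cong[OF eq, of "hdot w"] A zV u by (simp add: hdot_minus_right hdot_smult_right)
    ultimately have "hdot u z * (1 - hdot w u) = 0"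
      by (simp add: algebra_simps)
    then have hz: "hdot u z = 0"
      using w(2) by (simp add: u_def)
    then have "A *\<^sub>v z = 0\<^sub>v N"
      using eq A zV by (simp add: zu)
    then show "z \<in> ker A"
      using zV by (simp add: ker_def)
  next
    fix z assume z: "z \<in> ker A"
    have "hdot u z = 0"
      using hdot_adjoint[OF A w(1) ker_V[OF z]] kerD[OF z] by (simp add: u_def)
    then show "z \<in> ker (A - outer u)"
      using z A u by (simp add: ker_def minus_outer_mult zu)
  qed
  then show ?thesis
    using rk_eq_iff_card_ker[OF minus_outer_H[OF A, of u] A, of 0 0] by (simp add: u_def)
qed

text \<open>For \<open>x = y + s w\<close> with \<open>y\<close> in the hyperplane \<open>U\<close>,
  \<open>form A x\<close> is \<open>form A y + s^(q+1)\<close>, while \<open>form B x\<close> is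
  \<open>form A y\<close>. Hence for \<open>A\<close> each isotropic \<open>y\<close> admits one
  \<open>s\<close> and every other \<open>y\<close> admits \<open>q + 1\<close>, whereas for
  \<open>B\<close> exactly the isotropic \<open>y\<close> occur, with every
  \<open>s\<close>.\<close>

lemma card_isotropic_reduce:
  assumes A: "A \<in> H" and w: "w \<in> V" "form A w = 1"
  defines "B \<equiv> A - outer (A *\<^sub>v w)"
  shows "q ^ 2 * card {x \<in> V. form A x = 0} + q * card {x \<in> V. form B x = 0} = (q + 1) * q ^ (2 * N)"
proof -
  define u where "u = A *\<^sub>v w"
  define U where "U = {y \<in> V. hdot u y = 0}"
  define Y where "Y = {y \<in> U. form A y = 0}"
  have u: "u \<in> V"
    using A w by (simp add: u_def)
  have B: "B \<in> H"
    using A by (simp add: B_def minus_outer_H)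
  note ker = ker_minus_outer[OF A w, folded u_def]
  have fin: "finite U" "finite Y"
    by (simp_all add: U_def Y_def)
  have bij: "bij_betw (\<lambda>(y, s). y + s \<cdot>\<^sub>v w) (U \<times> UNIV) V"
    using bij_betw_hyperplane[of V w u] w ker(2) by (simp add: U_def)
  have cU: "q ^ (2 * N) = q ^ 2 * card U"
    using card_hyperplane[of V w u] w ker(2) card_V by (simp add: U_def)
  have Bx: "B *\<^sub>v x = A *\<^sub>v x - hdot u x \<cdot>\<^sub>v u" if "x \<in> V" for x
    using that A u by (simp add: B_def u_def[symmetric] minus_outer_mult)
  have wU: "hdot w u = 1"
    using w by (simp add: u_def)
  have yu: "hdot y u = 0" if "y \<in> U" for y
    using that hdot_frob[of u y] by (simp add: U_def)
  have formA: "form A (y + s \<cdot>\<^sub>v w) = form A y + s * s ^ q" if "y \<in> U" for y s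
  proof -
    have y: "y \<in> V" "hdot u y = 0"
      using that by (simp_all add: U_def)
    have "hdot w (A *\<^sub>v y) = 0"
      using hdot_adjoint[OF A w(1) y(1)] y(2) by (simp add: u_def)
    then show ?thesis
      using y A w u wU yu[OF that]
      by (simp add: H_linear hdot_add_left hdot_add_right hdot_smult_left hdot_smult_right u_def)
  qed
  have formB: "form B (y + s \<cdot>\<^sub>v w) = form A y" if "y \<in> U" for y s
  proof -
    have y: "y \<in> V" "hdot u y = 0"
      using that by (simp_all add: U_def)
    have Bw: "B *\<^sub>v w = 0\<^sub>v N"
      using kerD[OF ker(1)] by (simp add: B_def u_def)
    have "hdot w (B *\<^sub>v y) = 0"
      using hdot_adjoint[OF B w(1) y(1)] Bw by simp
    moreover have "hdot y (B *\<^sub>v y) = form A y"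
      using y u A by (simp add: Bx hdot_minus_right hdot_smult_right)
    ultimately show ?thesis
      using y B w Bw
      by (simp add: H_linear hdot_add_left hdot_add_right hdot_smult_left hdot_smult_right)
  qed
  have "bij_betw (\<lambda>(y, s). y + s \<cdot>\<^sub>v w) (Y \<times> UNIV) {x \<in> V. form B x = 0}"
    unfolding bij_betw_def
  proof
    show "inj_on (\<lambda>(y, s). y + s \<cdot>\<^sub>v w) (Y \<times> UNIV)"
      using bij unfolding bij_betw_def by (rule conjE) (erule inj_on_subset, auto simp: Y_def)
    show "(\<lambda>(y, s). y + s \<cdot>\<^sub>v w) ` (Y \<times> UNIV) = {x \<in> V. form B x = 0}"
    proof (intro equalityI subsetI)
      fix x assume x: "x \<in> {x \<in> V. form B x = 0}"
      then obtain y s where ys: "y \<in> U" "x = y + s \<cdot>\<^sub>v w"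
        using bij_betw_pairE[OF bij, of x] by auto
      then show "x \<in> (\<lambda>(y, s). y + s \<cdot>\<^sub>v w) ` (Y \<times> UNIV)"
        using x formB by (intro image_eqI[of _ _ "(y, s)"]) (auto simp: Y_def)
    qed (use formB w in \<open>auto simp: Y_def U_def\<close>)
  qed
  then have "card {x \<in> V. form B x = 0} = card (Y \<times> (UNIV :: 'a set))"
    by (rule bij_betw_same_card[symmetric])
  then have cB: "card {x \<in> V. form B x = 0} = q ^ 2 * card Y"
    by (simp add: card_cartesian_product card_field)
  have formreal: "(form A y) ^ q = form A y" if "y \<in> U" for y
    using hdot_frob[of y "A *\<^sub>v y"] hdot_adjoint[OF A, of y y] that by (simp add: U_def)
  define W where "W = (SIGMA y:U. {s. s * s ^ q = - form A y})"
  have "bij_betw (\<lambda>(y, s). y + s \<cdot>\<^sub>v w) W {x \<in> V. form A x = 0}"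
    unfolding bij_betw_def
  proof
    show "inj_on (\<lambda>(y, s). y + s \<cdot>\<^sub>v w) W"
      using bij unfolding bij_betw_def by (rule conjE) (erule inj_on_subset, auto simp: W_def)
    show "(\<lambda>(y, s). y + s \<cdot>\<^sub>v w) ` W = {x \<in> V. form A x = 0}"
    proof (intro equalityI subsetI)
      fix x assume x: "x \<in> {x \<in> V. form A x = 0}"
      then obtain y s where ys: "y \<in> U" "x = y + s \<cdot>\<^sub>v w"
        using bij_betw_pairE[OF bij, of x] by auto
      then have "s * s ^ q = - form A y"
        using formA x by (simp add: eq_neg_iff_add_eq_0 add.commute)
      then show "x \<in> (\<lambda>(y, s). y + s \<cdot>\<^sub>v w) ` W"
        using ys by (intro image_eqI[of _ _ "(y, s)"]) (auto simp: W_def)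
    qed (use formA w in \<open>auto simp: W_def U_def\<close>)
  qed
  then have "card {x \<in> V. form A x = 0} = card W"
    by (rule bij_betw_same_card[symmetric])
  also have "\<dots> = (\<Sum>y\<in>U. card {s. s * s ^ q = - form A y})"
    unfolding W_def using fin by (intro card_SigmaI) auto
  also have "\<dots> = (\<Sum>y\<in>Y. card {s. s * s ^ q = - form A y}) + (\<Sum>y\<in>U - Y. card {s. s * s ^ q = - form A y})"
    using fin by (subst add.commute, intro sum.subset_diff) (auto simp: Y_def)
  also have "(\<Sum>y\<in>Y. card {s. s * s ^ q = - form A y}) = card Y"
  proof -
    have "{s::'a. s * s ^ q = 0} = {0}"
      by auto
    then show ?thesis
      by (simp add: Y_def)
  qed
  also have "(\<Sum>y\<in>U - Y. card {s. s * s ^ q = - form A y}) = (\<Sum>y\<in>U - Y. q + 1)"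
    by (intro sum.cong card_norm_eq refl) (auto simp: Y_def formreal frob_minus)
  also have "\<dots> = (q + 1) * (card U - card Y)"
    using fin by (subst sum_constant) (simp add: card_Diff_subset Y_def mult.commute)
  finally have "card {x \<in> V. form A x = 0} = card Y + (q + 1) * (card U - card Y)" .
  moreover have "card Y \<le> card U"
    using fin by (intro card_mono) (auto simp: Y_def)
  then obtain d where "card U = card Y + d"
    using le_Suc_ex by blast
  ultimately show ?thesis
    using cB cU by (simp add: algebra_simps)
qed

end

section \<open>Intersection numbers of the Hermitian forms scheme\<close>

text \<open>The intersection numbers of the scheme, multiplied by \<open>q + 1\<close>. In \<open>herm_c\<close> the truncated exponent
  at \<open>i = 0\<close> is harmless because the other factor vanishes there.\<close>

definition herm_b :: "nat \<Rightarrow> nat \<Rightarrow> nat \<Rightarrow> int" where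
  "herm_b q N i = int q ^ (2 * N) - int q ^ (2 * i)"

definition herm_c :: "nat \<Rightarrow> nat \<Rightarrow> int" where
  "herm_c q i = int q ^ (i - 1) * (int q ^ i - (- 1) ^ i)"

definition herm_a :: "nat \<Rightarrow> nat \<Rightarrow> nat \<Rightarrow> int" where
  "herm_a q N i = int q ^ (2 * N) - 1 - herm_b q N i - herm_c q i"

context hermitian_geometry
begin

section \<open>Number of vectors with form value zero or one\<close>

lemma rk_zero [simp]: "rk (0\<^sub>m N N) = 0"
proof -
  have "ker (0\<^sub>m N N) = V"
    by (auto simp: ker_def intro!: eq_vecI)
  then have "q ^ (2 * N) * q ^ (2 * rk (0\<^sub>m N N)) = q ^ (2 * N) * 1"
    using card_ker_rk[OF H_zero] card_V by simp
  then show ?thesis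
    using q_gt_1 by simp
qed

text \<open>This solves the recursion of \<open>card_isotropic_reduce\<close>; the negative
  coefficient of the smaller rank there produces the sign \<open>(- 1) ^ rk A\<close>. The power of
  \<open>q\<close> on the left keeps the formula integral.\<close>

lemma card_isotropic:
  assumes "A \<in> H"
  shows "int q ^ (rk A + 1) * int (card {x \<in> V. form A x = 0}) =
    int q ^ (2 * N) * (int q ^ rk A + (- 1) ^ rk A * (int q - 1))"
  using assms
proof (induction A rule: hermitian_induct)
  case zero
  have "form (0\<^sub>m N N) x = 0" if "x \<in> V" for x
  proof -
    have "0\<^sub>m N N *\<^sub>v x = 0\<^sub>v N"
      using that by (intro eq_vecI) auto
    then show ?thesis
      by simp
  qed
  then have "{x \<in> V. form (0\<^sub>m N N) x = 0} = V"
    by blast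
  then show ?case
    by (simp add: card_V)
next
  case (reduce A w)
  define B where "B = A - outer (A *\<^sub>v w)"
  define r where "r = rk B"
  define Z Z' where "Z = int (card {x \<in> V. form A x = 0})" and "Z' = int (card {x \<in> V. form B x = 0})"
  have r: "rk A = Suc r"
    using rk_minus_outer[OF reduce(1-3)] by (simp add: r_def B_def)
  have "int (q ^ 2 * card {x \<in> V. form A x = 0} + q * card {x \<in> V. form B x = 0}) = int ((q + 1) * q ^ (2 * N))"
    using card_isotropic_reduce[OF reduce(1-3)] unfolding B_def by presburger
  then have rec: "int q ^ 2 * Z = (int q + 1) * int q ^ (2 * N) - int q * Z'"
    by (simp add: Z_def Z'_def algebra_simps)
  have IH: "int q ^ (r + 1) * Z' = int q ^ (2 * N) * (int q ^ r + (- 1) ^ r * (int q - 1))"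
    using reduce.IH by (simp add: r_def B_def Z'_def)
  have "int q ^ (Suc r + 1) * Z = int q ^ r * (int q ^ 2 * Z)"
    by (simp add: power2_eq_square)
  also have "\<dots> = int q ^ r * (int q + 1) * int q ^ (2 * N) - int q ^ (r + 1) * Z'"
    unfolding rec by (simp add: algebra_simps)
  also have "\<dots> = int q ^ (2 * N) * (int q ^ Suc r + (- 1) ^ Suc r * (int q - 1))"
    unfolding IH by (simp add: algebra_simps)
  finally show ?case
    by (simp add: r Z_def)
qed

text \<open>Pairs of a non-isotropic \<open>x\<close> and a scalar \<open>c\<close> of norm
  \<open>form A x\<close> correspond to pairs of the vector \<open>x / c\<close>, which has form
  value \<open>1\<close>, and an arbitrary nonzero \<open>c\<close>. This reduces the count to that
  of isotropic vectors.\<close>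

lemma card_form_eq_1:
  assumes A: "A \<in> H"
  shows "int q ^ (rk A + 1) * int (card {x \<in> V. form A x = 1}) =
    int q ^ (2 * N) * (int q ^ rk A - (- 1) ^ rk A)"
proof -
  let ?S = "SIGMA x:{x \<in> V. form A x \<noteq> 0}. {c. c * c ^ q = form A x}"
  let ?Z = "{x \<in> V. form A x = 0}" and ?O = "{x \<in> V. form A x = 1}"
  have fin: "finite ?Z" "finite {x \<in> V. form A x \<noteq> 0}"
    by simp_all
  have formreal: "(form A y) ^ q = form A y" if "y \<in> V" for y
    using hdot_frob[of y "A *\<^sub>v y"] hdot_adjoint[OF A, of y y] that by simp
  have form_smult: "form A (c \<cdot>\<^sub>v x) = c * c ^ q * form A x" if "x \<in> V" for c x
    using that A by (simp add: H_linear hdot_smult_left hdot_smult_right)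
  have "bij_betw (\<lambda>(x, c). (inverse c \<cdot>\<^sub>v x, c)) ?S (?O \<times> (UNIV - {0}))"
  proof (rule bij_betwI[of _ _ _ "\<lambda>(x, c). (c \<cdot>\<^sub>v x, c)"])
    show "(\<lambda>(x, c). (inverse c \<cdot>\<^sub>v x, c)) \<in> ?S \<rightarrow> ?O \<times> (UNIV - {0})"
    proof (rule Pi_I)
      fix p assume "p \<in> ?S"
      then obtain x c where p: "p = (x, c)" "x \<in> V" "form A x \<noteq> 0" "c * c ^ q = form A x"
        by auto
      have c: "c \<noteq> 0"
        using p(3,4) by auto
      have "form A (inverse c \<cdot>\<^sub>v x) = inverse (c * c ^ q) * form A x"
        using form_smult[OF p(2)] by (simp add: power_inverse)
      also have "\<dots> = 1"
        using p(3,4) by simp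
      finally show "(case p of (x, c) \<Rightarrow> (inverse c \<cdot>\<^sub>v x, c)) \<in> ?O \<times> (UNIV - {0})"
        using p c by simp
    qed
    show "(\<lambda>(x, c). (c \<cdot>\<^sub>v x, c)) \<in> ?O \<times> (UNIV - {0}) \<rightarrow> ?S"
      by (auto simp: form_smult)
    show "(case (case p of (x, c) \<Rightarrow> (inverse c \<cdot>\<^sub>v x, c)) of (x, c) \<Rightarrow> (c \<cdot>\<^sub>v x, c)) = p" if p: "p \<in> ?S" for p
    proof -
      obtain x c where p: "p = (x, c)" "x \<in> V" "form A x \<noteq> 0" "c * c ^ q = form A x"
        using p by auto
      have "c \<noteq> 0"
        using p(3,4) by auto
      then show ?thesis
        using p by (simp add: smult_smult_assoc)
    qed
  qed (auto simp: smult_smult_assoc)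
  then have "card ?S = card (?O \<times> (UNIV - {0::'a}))"
    by (rule bij_betw_same_card)
  then have "card ?S = card ?O * (q ^ 2 - 1)"
    by (simp add: card_cartesian_product card_Diff_singleton card_field)
  moreover have "card ?S = (\<Sum>x | x \<in> V \<and> form A x \<noteq> 0. card {c. c * c ^ q = form A x})"
    using fin by (intro card_SigmaI) auto
  moreover have "\<dots> = (\<Sum>x | x \<in> V \<and> form A x \<noteq> 0. q + 1)"
    by (intro sum.cong card_norm_eq refl) (auto simp: formreal)
  ultimately have 1: "card ?O * (q ^ 2 - 1) = (q + 1) * card {x \<in> V. form A x \<noteq> 0}"
    by (simp add: mult.commute)
  have "card ?Z + card {x \<in> V. form A x \<noteq> 0} = card (?Z \<union> {x \<in> V. form A x \<noteq> 0})"
    using fin by (intro card_Un_disjoint[symmetric]) auto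
  also have "?Z \<union> {x \<in> V. form A x \<noteq> 0} = V"
    by auto
  finally have 2: "int (card {x \<in> V. form A x \<noteq> 0}) = int q ^ (2 * N) - int (card ?Z)"
    by (simp add: card_V flip: of_nat_power)
  have "int (card ?O) * (int q ^ 2 - 1) = int (card ?O * (q ^ 2 - 1))"
    using q_gt_1 by (simp add: of_nat_diff)
  also have "\<dots> = int (q + 1) * int (card {x \<in> V. form A x \<noteq> 0})"
    by (simp only: 1 of_nat_mult)
  also have "\<dots> = (int q + 1) * (int q ^ (2 * N) - int (card ?Z))"
    by (simp only: 2 of_nat_add of_nat_1)
  finally have "(int q + 1) * (int (card ?O) * (int q - 1)) = (int q + 1) * (int q ^ (2 * N) - int (card ?Z))"
    by (simp add: algebra_simps power2_eq_square)
  then have "int (card ?O) * (int q - 1) = int q ^ (2 * N) - int (card ?Z)"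
    using q_gt_1 by (subst (asm) mult_cancel_left) auto
  then have "int q ^ (rk A + 1) * (int (card ?O) * (int q - 1)) =
      int q ^ (rk A + 1) * int q ^ (2 * N) - int q ^ (rk A + 1) * int (card ?Z)"
    by (simp only: right_diff_distrib)
  then have "(int q - 1) * (int q ^ (rk A + 1) * int (card ?O)) =
      int q ^ (rk A + 1) * int q ^ (2 * N) - int q ^ (rk A + 1) * int (card ?Z)"
    by (simp only: mult_ac)
  also have "\<dots> = (int q - 1) * (int q ^ (2 * N) * (int q ^ rk A - (- 1) ^ rk A))"
    unfolding card_isotropic[OF A] by (simp add: algebra_simps)
  finally show ?thesis
    using q_gt_1 by (subst (asm) mult_cancel_left) auto
qed

text \<open>These images are the vectors whose rank one form lowers the rank of \<open>A\<close>.
  The form is constant on cosets of \<open>ker A\<close>, so passing from \<open>x\<close> to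
  \<open>A x\<close> divides the count by \<open>card (ker A)\<close>.\<close>

lemma card_image_form_eq_1:
  assumes A: "A \<in> H"
  shows "int (card ((\<lambda>x. A *\<^sub>v x) ` {x \<in> V. form A x = 1})) = herm_c q (rk A)"
proof -
  let ?O = "{x \<in> V. form A x = 1}"
  define r where "r = rk A"
  define c where "c = int (card ((\<lambda>x. A *\<^sub>v x) ` ?O))"
  have "form A (x + z) = 1" if "x \<in> V" "form A x = 1" "z \<in> ker A" for x z
  proof -
    have z: "z \<in> V" "A *\<^sub>v z = 0\<^sub>v N"
      using that by (simp_all add: ker_def)
    have "hdot z (A *\<^sub>v x) = 0"
      using hdot_adjoint[OF A z(1) that(1)] z(2) by simp
    then show ?thesis
      using that z A by (simp add: H_linear hdot_add_left)
  qed
  then have "card ?O = card (ker A) * card ((\<lambda>x. A *\<^sub>v x) ` ?O)"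
    using A ker_V by (intro card_fibres) auto
  then have O: "int (card ?O) = int (card (ker A)) * c"
    by (simp add: c_def)
  have K: "int (card (ker A)) * int q ^ (2 * r) = int q ^ (2 * N)"
    using card_ker_rk[OF A] unfolding r_def by (metis of_nat_mult of_nat_power)
  then have kpos: "int (card (ker A)) \<noteq> 0"
    using q_gt_1 by auto
  have "int (card (ker A)) * (int q ^ (r + 1) * c) = int q ^ (r + 1) * int (card ?O)"
    unfolding O by simp
  also have "\<dots> = int (card (ker A)) * (int q ^ (2 * r) * (int q ^ r - (- 1) ^ r))"
    using card_form_eq_1[OF A] K by (simp add: r_def mult.assoc[symmetric])
  finally have "int q ^ (r + 1) * c = int q ^ (2 * r) * (int q ^ r - (- 1) ^ r)"
    using kpos by simp
  moreover have "int q ^ (2 * r) = int q ^ r * int q ^ r"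
    by (simp add: mult_2 power_add)
  ultimately have "int q ^ r * (int q * c) = int q ^ r * (int q ^ r * (int q ^ r - (- 1) ^ r))"
    by (simp add: mult_ac)
  then have qc: "int q * c = int q ^ r * (int q ^ r - (- 1) ^ r)"
    using q_gt_1 by simp
  have "c = herm_c q r"
  proof (cases r)
    case 0
    then show ?thesis
      using qc q_gt_1 by (simp add: herm_c_def)
  next
    case (Suc k)
    then have "int q * c = int q * herm_c q r"
      using qc by (simp add: herm_c_def)
    then show ?thesis
      using q_gt_1 by simp
  qed
  then show ?thesis
    by (simp add: r_def c_def)
qed

text \<open>Bookkeeping for \<open>card_rk_minus_outer\<close>: \<open>V'\<close> is the space,
  \<open>R'\<close> the range, \<open>O'\<close> the images of vectors of form value
  \<open>1\<close>, and \<open>z\<close> the zero vector, which lies in the middle level. Comparing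
  through \<open>Suc\<close> avoids truncation at rank zero.\<close>

lemma three_level_sets:
  fixes f :: "'b \<Rightarrow> nat"
  assumes "O' \<subseteq> R'" "R' \<subseteq> V'" "z \<in> R'" "z \<notin> O'"
    and f: "\<And>v. v \<in> V' - R' \<Longrightarrow> f v = Suc r" "\<And>v. v \<in> O' \<Longrightarrow> Suc (f v) = r" "\<And>v. v \<in> R' - O' \<Longrightarrow> f v = r"
  shows "{v \<in> V'. v \<noteq> z \<and> f v = Suc r} = V' - R'"
    and "{v \<in> V'. v \<noteq> z \<and> f v = r} = R' - O' - {z}"
    and "Suc j = r \<Longrightarrow> {v \<in> V'. v \<noteq> z \<and> f v = j} = O'"
    and "j \<noteq> Suc r \<Longrightarrow> j \<noteq> r \<Longrightarrow> Suc j \<noteq> r \<Longrightarrow> {v \<in> V'. v \<noteq> z \<and> f v = j} = {}"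
proof -
  have f': "f v = (if v \<in> O' then r - 1 else if v \<in> R' then r else Suc r)" "v \<in> O' \<Longrightarrow> r > 0" if "v \<in> V'" for v
    using f[of v] that by auto
  show "{v \<in> V'. v \<noteq> z \<and> f v = Suc r} = V' - R'"
    using f' assms(1-4) by (auto split: if_splits)
  show "{v \<in> V'. v \<noteq> z \<and> f v = r} = R' - O' - {z}"
  proof (rule Set.set_eqI)
    show "v \<in> {v \<in> V'. v \<noteq> z \<and> f v = r} \<longleftrightarrow> v \<in> R' - O' - {z}" for v
      using f'[of v] assms(1-4) by (cases "v \<in> O'"; cases "v \<in> R'") auto
  qed
  show "{v \<in> V'. v \<noteq> z \<and> f v = j} = O'" if "Suc j = r"
  proof (rule Set.set_eqI)
    show "v \<in> {v \<in> V'. v \<noteq> z \<and> f v = j} \<longleftrightarrow> v \<in> O'" for v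
      using f'[of v] assms(1-4) that by (cases "v \<in> O'"; cases "v \<in> R'") auto
  qed
  show "{v \<in> V'. v \<noteq> z \<and> f v = j} = {}" if "j \<noteq> Suc r" "j \<noteq> r" "Suc j \<noteq> r"
  proof (rule Set.set_eqI)
    show "v \<in> {v \<in> V'. v \<noteq> z \<and> f v = j} \<longleftrightarrow> v \<in> {}" for v
      using f'[of v] that by (cases "v \<in> O'"; cases "v \<in> R'") auto
  qed
qed

text \<open>The three lemmas on \<open>A - outer v\<close> cover all \<open>v\<close>: outside the
  range, in the range with form value \<open>1\<close>, and the remaining range. The counts depend
  on \<open>rk A\<close> alone, which is what yields a tridiagonal matrix. Removing the zero vector
  accounts for the \<open>- 1\<close> in \<open>herm_a\<close>.\<close>

lemma card_rk_minus_outer: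
  assumes A: "A \<in> H"
  shows "int (card {v \<in> V. v \<noteq> 0\<^sub>v N \<and> rk (A - outer v) = j}) =
    (if j = Suc (rk A) then herm_b q N (rk A) else if j = rk A then herm_a q N (rk A)
     else if Suc j = rk A then herm_c q (rk A) else 0)"
proof -
  let ?r = "rk A" and ?f = "\<lambda>x. A *\<^sub>v x"
  let ?O = "?f ` {x \<in> V. form A x = 1}" and ?R = "?f ` V"
  define S where "S j = {v \<in> V. v \<noteq> 0\<^sub>v N \<and> rk (A - outer v) = j}" for j
  have zero: "?f (0\<^sub>v N) = 0\<^sub>v N"
    using zero_ker[OF A] by (simp add: ker_def)
  have O0: "0\<^sub>v N \<notin> ?O"
  proof
    assume "0\<^sub>v N \<in> ?O"
    then obtain x where x: "x \<in> V" "0\<^sub>v N = A *\<^sub>v x" "form A x = 1"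
      by auto
    show False
      using x(3) unfolding x(2)[symmetric] by simp
  qed
  have R0: "0\<^sub>v N \<in> ?R"
    using zero by (intro image_eqI[of _ _ "0\<^sub>v N"]) auto
  have RV: "?R \<subseteq> V"
    using A by auto
  have OR: "?O \<subseteq> ?R"
    by auto
  have out: "rk (A - outer v) = Suc ?r" if "v \<in> V - ?R" for v
    using rk_minus_outer_notin_range[OF A] that by auto
  have ino: "Suc (rk (A - outer v)) = ?r" if "v \<in> ?O" for v
    using that rk_minus_outer[OF A] by auto
  have inr: "rk (A - outer v) = ?r" if "v \<in> ?R - ?O" for v
  proof -
    obtain w where w: "w \<in> V" "v = A *\<^sub>v w"
      using \<open>v \<in> ?R - ?O\<close> by auto
    then have "form A w \<noteq> 1"
      using \<open>v \<in> ?R - ?O\<close> by auto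
    then show ?thesis
      using rk_minus_outer_other[OF A w(1)] w(2) by simp
  qed
  have fin: "finite ?R" "finite ?O"
    by (rule finite_imageI, simp)+
  have cR: "int (card ?R) = int q ^ (2 * ?r)"
    using card_range_rk[OF A] by simp
  note levels = three_level_sets[where f = "\<lambda>v. rk (A - outer v)", OF OR RV R0 O0 out ino inr]
  have Sb: "S (Suc ?r) = V - ?R"
    unfolding S_def by (rule levels(1))
  have Sa: "S ?r = ?R - ?O - {0\<^sub>v N}"
    unfolding S_def by (rule levels(2))
  have Sc: "S j = ?O" if "Suc j = ?r" for j
    unfolding S_def by (rule levels(3)) (assumption | rule that)+
  have Sd: "S j = {}" if "j \<noteq> Suc ?r" "j \<noteq> ?r" "Suc j \<noteq> ?r" for j
    unfolding S_def by (rule levels(4)) (assumption | rule that)+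
  have "int (card (S (Suc ?r))) = herm_b q N ?r"
    unfolding Sb herm_b_def using RV fin cR card_V card_mono[OF finite_V RV]
    by (simp add: card_Diff_subset of_nat_diff)
  moreover have "int (card (S ?r)) = herm_a q N ?r"
  proof -
    have "card (?R - ?O) = card ?R - card ?O" "card ?O \<le> card ?R"
      using OR fin by (simp_all add: card_Diff_subset card_mono)
    moreover have "card (?R - ?O - {0\<^sub>v N}) = card (?R - ?O) - 1" "card (?R - ?O) > 0"
      using O0 R0 fin by (auto simp: card_gt_0_iff)
    ultimately show ?thesis
      unfolding Sa herm_a_def herm_b_def card_image_form_eq_1[OF A, symmetric] cR[symmetric]
      by (simp add: of_nat_diff)
  qed
  moreover have "int (card (S j)) = herm_c q ?r" if "Suc j = ?r"
    unfolding Sc[OF that] by (rule card_image_form_eq_1[OF A])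
  ultimately have "int (card (S j)) =
    (if j = Suc ?r then herm_b q N ?r else if j = ?r then herm_a q N ?r
     else if Suc j = ?r then herm_c q ?r else 0)"
    using Sd by simp
  then show ?thesis
    by (simp only: S_def)
qed

lemma rk_le: "A \<in> H \<Longrightarrow> rk A \<le> N"
  using vec_space.rank_le_nc H_carrier by blast

lemma exists_rk:
  assumes "r \<le> N"
  shows "\<exists>A\<in>H. rk A = r"
  using assms
proof (induction r)
  case 0
  then show ?case
    using H_zero rk_zero by blast
next
  case (Suc r)
  then obtain A where A: "A \<in> H" "rk A = r"
    by auto
  have "(\<lambda>x. A *\<^sub>v x) ` V \<noteq> V"
    using card_range_rk[OF A(1)] card_V A(2) Suc.prems q_gt_1 by auto
  then obtain v where "v \<in> V" "v \<notin> (\<lambda>x. A *\<^sub>v x) ` V"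
    using A(1) by auto
  then show ?case
    using rk_minus_outer_notin_range[OF A(1)] A minus_outer_H by metis
qed

lemma rk_eq_0_iff: "A \<in> H \<Longrightarrow> rk A = 0 \<longleftrightarrow> A = 0\<^sub>m N N"
  using exists_form_eq_1[of A] rk_minus_outer[of A] by (cases "A = 0\<^sub>m N N") fastforce+

end

section \<open>Metric schemes and their eigenmatrices\<close>

lemma mat_prod_assoc:
  "mat_prod X (mat_prod X K L) M = mat_prod X K (mat_prod X L M)"
proof (intro ext)
  fix x y
  have "mat_prod X (mat_prod X K L) M x y = (\<Sum>z\<in>X. \<Sum>w\<in>X. K x w * L w z * M z y)"
    by (simp add: mat_prod_def sum_distrib_right)
  also have "\<dots> = (\<Sum>w\<in>X. \<Sum>z\<in>X. K x w * L w z * M z y)"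
    by (rule sum.swap)
  also have "\<dots> = mat_prod X K (mat_prod X L M) x y"
    by (simp add: mat_prod_def sum_distrib_left mult.assoc)
  finally show "mat_prod X (mat_prod X K L) M x y = mat_prod X K (mat_prod X L M) x y" .
qed

lemma mat_prod_sum_left:
  "mat_prod X (\<lambda>x y. \<Sum>j\<in>J. c j * F j x y) M = (\<lambda>x y. \<Sum>j\<in>J. c j * mat_prod X (F j) M x y)"
  unfolding mat_prod_def
  by (intro ext, simp add: sum_distrib_left sum_distrib_right mult.assoc, rule sum.swap)

lemma mat_prod_diff_left:
  "mat_prod X (\<lambda>x y. F x y - G x y) M = (\<lambda>x y. mat_prod X F M x y - mat_prod X G M x y)"
  unfolding mat_prod_def by (simp add: left_diff_distrib sum_subtractf)

lemma mat_prod_smult_left: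
  "mat_prod X (\<lambda>x y. c * F x y) M = (\<lambda>x y. c * mat_prod X F M x y)"
  unfolding mat_prod_def by (simp add: sum_distrib_left mult.assoc)

lemma mat_prod_smult_right:
  "mat_prod X M (\<lambda>x y. c * F x y) = (\<lambda>x y. c * mat_prod X M F x y)"
  unfolding mat_prod_def by (simp add: sum_distrib_left algebra_simps)

lemma mat_prod_zero_left: "mat_prod X (\<lambda>_ _. 0) M = (\<lambda>_ _. 0)"
  by (simp add: mat_prod_def)

text \<open>Row \<open>k\<close> lists the transitions out of level \<open>k\<close>:
  \<open>b k\<close> up, \<open>a k\<close> level, \<open>c k\<close> down. The products with
  \<open>adj_matrix (R j)\<close> therefore use column \<open>j\<close>.\<close>

definition tridiag :: "(nat \<Rightarrow> 'c::zero) \<Rightarrow> (nat \<Rightarrow> 'c) \<Rightarrow> (nat \<Rightarrow> 'c) \<Rightarrow> nat \<Rightarrow> nat \<Rightarrow> 'c" where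
  "tridiag c a b k j = (if j = Suc k then b k else if j = k then a k else if Suc j = k then c k else 0)"

lemma sum_tridiag_col:
  fixes f :: "nat \<Rightarrow> 'c::comm_ring_1"
  assumes "Suc j \<le> d"
  shows "(\<Sum>k\<le>d. tridiag c a b k j * f k) =
    c (Suc j) * f (Suc j) + a j * f j + (if j = 0 then 0 else b (j - 1) * f (j - 1))"
proof -
  have "(\<Sum>k\<le>d. tridiag c a b k j * f k) = (\<Sum>k\<in>{Suc j, j} \<union> (if j = 0 then {} else {j - 1}). tridiag c a b k j * f k)"
    using assms by (intro sum.mono_neutral_right) (auto simp: tridiag_def split: if_splits)
  then show ?thesis
    using assms by (auto simp: tridiag_def)
qed

text \<open>Only left multiplication by the single matrix \<open>S\<close> is assumed; closure under
  products and commutativity are derived. \<open>S\<close> is left unnormalised, as counts of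
  vectors carry the factor \<open>q + 1\<close>. Nonzero \<open>c j\<close> allow the recurrence to
  be solved for the next adjacency matrix.\<close>

locale metric_scheme =
  fixes X :: "'x set" and R :: "nat \<Rightarrow> ('x \<times> 'x) set" and d :: nat
    and S :: "'x \<Rightarrow> 'x \<Rightarrow> complex" and c a b :: "nat \<Rightarrow> complex"
  assumes finite_X: "finite X"
    and R_subset: "R j \<subseteq> X \<times> X"
    and R_disjoint: "i \<noteq> j \<Longrightarrow> R i \<inter> R j = {}"
    and R_sym: "(x, y) \<in> R j \<Longrightarrow> (y, x) \<in> R j"
    and R_0: "R 0 = Id_on X"
    and R_nonempty: "j \<le> d \<Longrightarrow> R j \<noteq> {}"
    and S_recurrence: "j \<le> d \<Longrightarrow>
      mat_prod X S (adj_matrix (R j)) = (\<lambda>x y. \<Sum>k\<le>d. tridiag c a b k j * adj_matrix (R k) x y)"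
    and S_outside: "y \<notin> X \<Longrightarrow> S x y = 0"
    and c_nonzero: "0 < j \<Longrightarrow> j \<le> d \<Longrightarrow> c j \<noteq> 0"
    and a_0: "a 0 = 0"
    and d_pos: "d > 0"
begin

abbreviation A :: "nat \<Rightarrow> 'x \<Rightarrow> 'x \<Rightarrow> complex" where
  "A j \<equiv> adj_matrix (R j)"

abbreviation mp :: "('x \<Rightarrow> 'x \<Rightarrow> complex) \<Rightarrow> ('x \<Rightarrow> 'x \<Rightarrow> complex) \<Rightarrow> 'x \<Rightarrow> 'x \<Rightarrow> complex" where
  "mp \<equiv> mat_prod X"

abbreviation BM :: "('x \<Rightarrow> 'x \<Rightarrow> complex) set" where
  "BM \<equiv> bose_mesner R d"

section \<open>The Bose-Mesner algebra is closed and commutative\<close>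

lemma BM_I: "(\<lambda>x y. \<Sum>j\<le>d. \<alpha> j * A j x y) \<in> BM"
  by (auto simp: bose_mesner_def)

lemma BM_E:
  assumes "M \<in> BM"
  obtains \<alpha> where "M = (\<lambda>x y. \<Sum>j\<le>d. \<alpha> j * A j x y)"
  using assms by (auto simp: bose_mesner_def fun_eq_iff)

lemma BM_diff:
  assumes "M \<in> BM" "L \<in> BM"
  shows "(\<lambda>x y. M x y - L x y) \<in> BM"
proof -
  obtain \<alpha> where M: "M = (\<lambda>x y. \<Sum>j\<le>d. \<alpha> j * A j x y)"
    by (rule BM_E[OF assms(1)])
  obtain \<beta> where L: "L = (\<lambda>x y. \<Sum>j\<le>d. \<beta> j * A j x y)"
    by (rule BM_E[OF assms(2)])
  show ?thesis
    using BM_I[of "\<lambda>j. \<alpha> j - \<beta> j"] by (simp add: M L left_diff_distrib sum_subtractf)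
qed

lemma BM_smult:
  assumes "M \<in> BM"
  shows "(\<lambda>x y. t * M x y) \<in> BM"
proof -
  obtain \<alpha> where "M = (\<lambda>x y. \<Sum>j\<le>d. \<alpha> j * A j x y)"
    by (rule BM_E[OF assms])
  then show ?thesis
    using BM_I[of "\<lambda>j. t * \<alpha> j"] by (simp add: sum_distrib_left mult.assoc)
qed

lemma BM_zero: "(\<lambda>_ _. 0) \<in> BM"
  using BM_I[of "\<lambda>_. 0"] by simp

lemma BM_sum:
  assumes "finite J" "\<And>j. j \<in> J \<Longrightarrow> F j \<in> BM"
  shows "(\<lambda>x y. \<Sum>j\<in>J. \<alpha> j * F j x y) \<in> BM"
  using assms
proof (induction J)
  case (insert j J)
  have "(\<lambda>x y. (\<Sum>j\<in>J. \<alpha> j * F j x y) - (- \<alpha> j) * F j x y) \<in> BM"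
    using insert by (intro BM_diff BM_smult) auto
  then show ?case
    using insert.hyps by (simp add: add.commute)
qed (simp add: BM_zero)

lemma sum_A:
  assumes "(x, y) \<in> R k" "k \<le> d"
  shows "(\<Sum>j\<le>d. \<alpha> j * A j x y) = \<alpha> k"
proof -
  have "(\<Sum>j\<le>d. \<alpha> j * A j x y) = (\<Sum>j\<le>d. if j = k then \<alpha> k else 0)"
    using assms R_disjoint by (intro sum.cong) (auto simp: adj_matrix_def)
  then show ?thesis
    using assms(2) by simp
qed

lemma BM_outside:
  assumes "M \<in> BM" "x \<notin> X \<or> y \<notin> X"
  shows "M x y = 0"
proof -
  have "A j x y = 0" for j
    using R_subset[of j] assms(2) by (auto simp: adj_matrix_def)
  then show ?thesis
    using assms(1) by (elim BM_E) simp
qed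

lemma mp_identity:
  assumes "M \<in> BM"
  shows "mp (A 0) M = M"
proof (intro ext)
  fix x y
  show "mp (A 0) M x y = M x y"
  proof (cases "x \<in> X")
    case True
    then have "mp (A 0) M x y = (\<Sum>z\<in>X. if z = x then M x y else 0)"
      unfolding mat_prod_def by (intro sum.cong) (auto simp: adj_matrix_def R_0)
    then show ?thesis
      using True finite_X by simp
  next
    case False
    then show ?thesis
      using BM_outside[OF assms] by (auto simp: mat_prod_def adj_matrix_def R_0 intro!: sum.neutral)
  qed
qed

text \<open>\<open>A 0\<close> is the identity on \<open>X\<close>, and column \<open>0\<close> of
  the tridiagonal matrix reduces to \<open>c 1\<close> because \<open>a 0 = 0\<close>; this is the
  recurrence at \<open>j = 0\<close>.\<close>

lemma S_eq: "S = (\<lambda>x y. c 1 * A 1 x y)"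
proof (intro ext)
  fix x y
  have "mp S (A 0) x y = S x y"
  proof (cases "y \<in> X")
    case True
    then have "mp S (A 0) x y = (\<Sum>z\<in>X. if z = y then S x y else 0)"
      unfolding mat_prod_def by (intro sum.cong) (auto simp: adj_matrix_def R_0)
    then show ?thesis
      using True finite_X by simp
  next
    case False
    then show ?thesis
      by (auto simp: mat_prod_def adj_matrix_def R_0 S_outside intro!: sum.neutral)
  qed
  moreover have "(\<Sum>k\<le>d. tridiag c a b k 0 * A k x y) = (\<Sum>k\<le>d. if k = 1 then c 1 * A 1 x y else 0)"
    by (intro sum.cong) (auto simp: tridiag_def a_0)
  ultimately show "S x y = c 1 * A 1 x y"
    using S_recurrence[of 0] d_pos by simp
qed

lemma mp_S_BM: "M \<in> BM \<Longrightarrow> mp S M \<in> BM"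
proof (elim BM_E)
  fix \<alpha> assume M: "M = (\<lambda>x y. \<Sum>j\<le>d. \<alpha> j * A j x y)"
  have "mp S M = (\<lambda>x y. \<Sum>j\<le>d. \<alpha> j * mp S (A j) x y)"
    unfolding M mat_prod_def
    by (intro ext, simp add: sum_distrib_left sum_distrib_right mult_ac, rule sum.swap)
  then show "mp S M \<in> BM"
    using BM_sum[of "{..d}" "\<lambda>j. mp S (A j)" \<alpha>] S_recurrence BM_I by simp
qed

text \<open>The recurrence writes the next adjacency matrix in terms of \<open>S\<close> times the
  current one and of the two preceding ones, so multiplication by it reduces to smaller indices and
  to multiplication by \<open>S\<close>.\<close>

lemma mp_A_BM: "k \<le> d \<Longrightarrow> M \<in> BM \<Longrightarrow> mp (A k) M \<in> BM"
proof (induction k arbitrary: M rule: less_induct)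
  case (less k)
  show ?case
  proof (cases k)
    case 0
    then show ?thesis
      using less.prems mp_identity by simp
  next
    case (Suc j)
    define L where "L = (\<lambda>x y. if j = 0 then 0 else b (j - 1) * A (j - 1) x y)"
    have c: "c k \<noteq> 0"
      using c_nonzero less.prems Suc by simp
    have "mp S (A j) x y = c k * A k x y + a j * A j x y + L x y" for x y
      using S_recurrence[of j] sum_tridiag_col[of j d c a b "\<lambda>k. A k x y"] less.prems Suc
      by (simp add: L_def)
    then have "A k = (\<lambda>x y. inverse (c k) * (mp S (A j) x y - a j * A j x y - L x y))"
      using c by (intro ext) simp
    then have "mp (A k) M = mp (\<lambda>x y. inverse (c k) * (mp S (A j) x y - a j * A j x y - L x y)) M"
      by simp
    also have "\<dots> = (\<lambda>x y. inverse (c k) * (mp S (mp (A j) M) x y - a j * mp (A j) M x y - mp L M x y))"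
      by (simp only: mat_prod_smult_left mat_prod_diff_left mat_prod_assoc)
    finally have eq: "mp (A k) M =
      (\<lambda>x y. inverse (c k) * (mp S (mp (A j) M) x y - a j * mp (A j) M x y - mp L M x y))" .
    have "mp (A j) M \<in> BM"
      using less Suc by simp
    moreover have "mp L M \<in> BM"
    proof (cases "j = 0")
      case True
      then show ?thesis
        by (simp add: L_def mat_prod_zero_left BM_zero)
    next
      case False
      then have "mp (A (j - 1)) M \<in> BM"
        using less Suc by simp
      then show ?thesis
        using False by (simp add: L_def mat_prod_smult_left BM_smult)
    qed
    ultimately show ?thesis
      unfolding eq by (intro BM_smult BM_diff mp_S_BM)
  qed
qed

lemma mp_BM: 
  assumes "M \<in> BM" "L \<in> BM"
  shows "mp M L \<in> BM"
proof -
  obtain \<alpha> where M: "M = (\<lambda>x y. \<Sum>j\<le>d. \<alpha> j * A j x y)"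
    by (rule BM_E[OF assms(1)])
  show ?thesis
    unfolding M mat_prod_sum_left using assms mp_A_BM by (intro BM_sum) auto
qed

lemma BM_sym:
  assumes "M \<in> BM"
  shows "M x y = M y x"
proof -
  have "A j x y = A j y x" for j
    using R_sym by (auto simp: adj_matrix_def)
  then show ?thesis
    using assms by (elim BM_E) simp
qed

text \<open>The product lies in the algebra and is therefore symmetric, like its factors;
  transposing it exchanges them.\<close>

lemma mp_commute:
  assumes "M \<in> BM" "L \<in> BM"
  shows "mp M L = mp L M"
proof (intro ext)
  fix x y
  have "mp M L x y = mp M L y x"
    using mp_BM[OF assms] by (rule BM_sym)
  also have "\<dots> = mp L M x y"
    unfolding mat_prod_def using BM_sym[OF assms(1)] BM_sym[OF assms(2)]
    by (intro sum.cong) (auto simp: mult.commute)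
  finally show "mp M L x y = mp L M x y" .
qed

text \<open>The product is an idempotent below both factors, so by minimality it is zero or equal to
  each of them.\<close>

lemma primitive_idempotents_orthogonal:
  assumes EF: "E \<in> primitive_idempotents X R d" "F \<in> primitive_idempotents X R d" "E \<noteq> F"
  shows "mp E F = (\<lambda>_ _. 0)"
proof -
  have E: "E \<in> BM" "mp E E = E" and F: "F \<in> BM" "mp F F = F"
    using EF by (auto simp: primitive_idempotents_def idempotents_def)
  note com = mp_commute[OF E(1) F(1)]
  let ?G = "mp E F"
  have GE: "mp E ?G = ?G"
    by (metis mat_prod_assoc E(2))
  have GF: "mp ?G F = ?G"
    by (metis mat_prod_assoc F(2))
  have GE': "mp ?G E = ?G" 
    by (metis mat_prod_assoc E(2) com)
  have GF': "mp F ?G = ?G"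
    by (metis mat_prod_assoc F(2) com)
  have "mp ?G ?G = ?G"
    by (metis GE' GF mat_prod_assoc)
  then have "?G \<in> idempotents X R d"
    using mp_BM E F by (simp add: idempotents_def)
  then have "?G = (\<lambda>_ _. 0) \<or> ?G = E" "?G = (\<lambda>_ _. 0) \<or> ?G = F"
    using EF GE GF GE' GF' unfolding primitive_idempotents_def by blast+
  then show ?thesis
    using EF(3) by metis
qed

context
  fixes E :: "nat \<Rightarrow> 'x \<Rightarrow> 'x \<Rightarrow> complex"
  assumes bij: "bij_betw E {..d} (primitive_idempotents X R d)"
begin

lemma E_primitive: "i \<le> d \<Longrightarrow> E i \<in> primitive_idempotents X R d"
  using bij by (auto simp: bij_betw_def)

lemma E_props:
  assumes "i \<le> d"
  shows "E i \<in> BM" "mp (E i) (E i) = E i" "E i \<noteq> (\<lambda>_ _. 0)"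
  using E_primitive[OF assms] by (auto simp: primitive_idempotents_def idempotents_def)

lemma E_orthogonal: "i \<le> d \<Longrightarrow> j \<le> d \<Longrightarrow> i \<noteq> j \<Longrightarrow> mp (E i) (E j) = (\<lambda>_ _. 0)"
  using bij E_primitive by (intro primitive_idempotents_orthogonal) (auto simp: bij_betw_def inj_on_def)

lemma smult_E_inject:
  assumes "i \<le> d" "(\<lambda>x y. s * E i x y) = (\<lambda>x y. t * E i x y)"
  shows "s = t"
proof -
  obtain x y where "E i x y \<noteq> 0"
    using E_props(3)[OF assms(1)] by (auto simp: fun_eq_iff)
  moreover have "s * E i x y = t * E i x y"
    using assms(2) by meson
  ultimately show ?thesis
    by simp
qed

context
  fixes P :: "complex mat"
  assumes P: "is_first_eigenmatrix R d E P"
begin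

lemma mp_A_E:
  assumes "i \<le> d" "j \<le> d"
  shows "mp (A j) (E i) = (\<lambda>x y. P $$ (i, j) * E i x y)"
proof -
  have "A j = (\<lambda>x y. \<Sum>k\<le>d. P $$ (k, j) * E k x y)"
    using P assms(2) by (auto simp: is_first_eigenmatrix_def fun_eq_iff)
  then have "mp (A j) (E i) = (\<lambda>x y. \<Sum>k\<le>d. P $$ (k, j) * mp (E k) (E i) x y)"
    by (simp only: mat_prod_sum_left)
  also have "\<dots> = (\<lambda>x y. \<Sum>k\<le>d. if k = i then P $$ (i, j) * E i x y else 0)"
    using assms E_orthogonal E_props(2) by (intro ext sum.cong) auto
  finally show ?thesis
    using assms by simp
qed

lemma P_col_0:
  assumes "i \<le> d"
  shows "P $$ (i, 0) = 1"
proof -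
  have "(\<lambda>x y. P $$ (i, 0) * E i x y) = (\<lambda>x y. 1 * E i x y)"
    using mp_A_E[OF assms, of 0] mp_identity[OF E_props(1)[OF assms]] by simp
  then show ?thesis
    by (rule smult_E_inject[OF assms])
qed

text \<open>The product \<open>S (A j) (E i)\<close> is evaluated once by successive eigenvalues and
  once through the recurrence.\<close>

lemma P_recurrence:
  assumes "i \<le> d" "j \<le> d"
  shows "c 1 * P $$ (i, 1) * P $$ (i, j) = (\<Sum>k\<le>d. P $$ (i, k) * tridiag c a b k j)"
proof -
  have SE: "mp S (E i) = (\<lambda>x y. c 1 * P $$ (i, 1) * E i x y)"
    using mp_A_E[of i 1] assms d_pos unfolding S_eq mat_prod_smult_left by (simp add: mult.assoc)
  have "mp (mp S (A j)) (E i) = mp S (\<lambda>x y. P $$ (i, j) * E i x y)"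
    using assms by (simp add: mat_prod_assoc mp_A_E)
  also have "\<dots> = (\<lambda>x y. c 1 * P $$ (i, 1) * P $$ (i, j) * E i x y)"
    unfolding mat_prod_smult_right SE by (simp add: algebra_simps)
  finally have "(\<lambda>x y. c 1 * P $$ (i, 1) * P $$ (i, j) * E i x y) = mp (mp S (A j)) (E i)"
    by simp
  also have "\<dots> = (\<lambda>x y. \<Sum>k\<le>d. tridiag c a b k j * mp (A k) (E i) x y)"
    unfolding S_recurrence[OF assms(2)] mat_prod_sum_left ..
  also have "\<dots> = (\<lambda>x y. (\<Sum>k\<le>d. P $$ (i, k) * tridiag c a b k j) * E i x y)"
    using assms by (simp add: mp_A_E sum_distrib_left algebra_simps)
  finally show ?thesis
    by (rule smult_E_inject[OF assms(1)])
qed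

end

lemma P_unique:
  assumes "is_first_eigenmatrix R d E P" "is_first_eigenmatrix R d E P'" "i \<le> d" "j \<le> d"
  shows "P $$ (i, j) = P' $$ (i, j)"
  using mp_A_E[OF assms(1,3,4)] mp_A_E[OF assms(2,3,4)]
  by (intro smult_E_inject[OF assms(3)]) simp

end

text \<open>At a pair in \<open>R i\<close> the second eigenmatrix gives \<open>|X| E k\<close> the
  value \<open>Q(i, k)\<close>, and inserting this into the expansion of \<open>A j\<close> yields
  \<open>Q P = |X| I\<close>. The matrix witnessing self-duality is existential; uniqueness of the
  first eigenmatrix identifies it with \<open>P\<close>.\<close>

lemma P_square:
  assumes sd: "self_dual_ordering X R d E" and P: "is_first_eigenmatrix R d E P"
    and ij: "i \<le> d" "j \<le> d"
  shows "(\<Sum>k\<le>d. P $$ (i, k) * P $$ (k, j)) = (if i = j then of_nat (card X) else 0)"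
proof -
  obtain Q where bij: "bij_betw E {..d} (primitive_idempotents X R d)"
    and Q: "is_first_eigenmatrix R d E Q" "is_second_eigenmatrix X R d E Q"
    using sd by (auto simp: self_dual_ordering_def)
  note PQ = P_unique[OF bij P Q(1)]
  obtain x y where xy: "(x, y) \<in> R i"
    using R_nonempty[OF ij(1)] by auto
  have E: "of_nat (card X) * E k x y = P $$ (i, k)" if "k \<le> d" for k
  proof -
    have "of_nat (card X) * E k x y = (\<Sum>i\<le>d. Q $$ (i, k) * A i x y)"
      using Q(2) that by (auto simp: is_second_eigenmatrix_def)
    then show ?thesis
      using sum_A[OF xy ij(1), of "\<lambda>i. Q $$ (i, k)"] PQ ij that by simp
  qed
  have "of_nat (card X) * A j x y = of_nat (card X) * (\<Sum>k\<le>d. P $$ (k, j) * E k x y)"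
    using P ij by (auto simp: is_first_eigenmatrix_def)
  also have "\<dots> = (\<Sum>k\<le>d. P $$ (k, j) * (of_nat (card X) * E k x y))"
    by (simp add: sum_distrib_left algebra_simps)
  also have "\<dots> = (\<Sum>k\<le>d. P $$ (i, k) * P $$ (k, j))"
    using E by (intro sum.cong) auto
  finally have "(\<Sum>k\<le>d. P $$ (i, k) * P $$ (k, j)) = of_nat (card X) * A j x y"
    by simp
  moreover have "A j x y = (if i = j then 1 else 0)"
    using xy R_disjoint[of i j] by (auto simp: adj_matrix_def)
  ultimately show ?thesis
    by simp
qed

end

section \<open>The eigenvalues of the Hermitian forms scheme\<close>

lemma sum_tridiag_row:
  fixes f :: "nat \<Rightarrow> 'c::comm_ring_1"
  assumes "k \<le> d" "c 0 = 0" "b d = 0"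
  shows "(\<Sum>j\<le>d. tridiag c a b k j * f j) = c k * f (k - 1) + a k * f k + b k * f (Suc k)"
proof -
  have "(\<Sum>j\<le>d. tridiag c a b k j * f j) = (\<Sum>j\<in>({k} \<union> (if k = 0 then {} else {k - 1})) \<union> (if k = d then {} else {Suc k}). tridiag c a b k j * f j)"
    using assms(1) by (intro sum.mono_neutral_right) (auto simp: tridiag_def split: if_splits)
  then show ?thesis
    using assms by (auto simp: tridiag_def)
qed

text \<open>A term whose exponent is strictly smallest cannot be balanced by multiples of a higher
  power of \<open>b\<close>. The solution that has to survive is \<open>s = 1\<close>,
  \<open>t = 2\<close>, for which the equation is an identity.\<close>

lemma integer_power_equation:
  fixes b :: int
  assumes b: "\<bar>b\<bar> > 1" and s: "s \<noteq> 0" "s \<le> N" and t: "t \<le> N" "t \<noteq> s" and N: "N > 2"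
    and eq: "b ^ (2 * N + 2 * s) - b ^ (2 * s + 2) =
      b ^ (2 * N + t) - b ^ (s + t + 2) - b ^ (s + t + 1) + b ^ (2 * s + t + 1)"
  shows "s = 1"
proof (rule ccontr)
  assume "s \<noteq> 1"
  then have s2: "s \<ge> 2"
    using s(1) by simp
  have ndvd: "\<not> b ^ Suc L dvd b ^ L" for L
  proof
    assume "b ^ Suc L dvd b ^ L"
    then have "\<bar>b\<bar> ^ Suc L \<le> \<bar>b\<bar> ^ L"
      using b zdvd_imp_le[of "\<bar>b\<bar> ^ Suc L" "\<bar>b\<bar> ^ L"] by (simp add: power_abs[symmetric])
    moreover have "\<bar>b\<bar> ^ L < \<bar>b\<bar> ^ Suc L"
      using b by (intro power_strict_increasing) auto
    ultimately show False
      by linarith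
  qed
  have dvd: "b ^ Suc L dvd b ^ k" if "L < k" for L k
    using that by (intro le_imp_power_dvd) simp
  consider "t < s" | "t = Suc s" | "Suc s < t"
    using t(2) by linarith
  then show False
  proof cases
    case 1
    let ?L = "s + t + 1"
    have "b ^ ?L = b ^ (2 * N + t) - b ^ (s + t + 2) + b ^ (2 * s + t + 1) - b ^ (2 * N + 2 * s) + b ^ (2 * s + 2)"
      using eq by simp
    moreover have "b ^ Suc ?L dvd \<dots>"
      using 1 s s2 t N by (intro dvd_add dvd_diff dvd) auto
    ultimately show False
      using ndvd[of ?L] by metis
  next
    case 2
    \<comment> \<open>Here the terms with exponents \<open>2 * s + 2\<close> and
      \<open>s + t + 1\<close> cancel, so the next exponent decides; \<open>s \<ge> 2\<close> puts
      \<open>2 * s + t + 1\<close> above it.\<close>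
    let ?L = "2 * s + 3"
    have "s + t + 1 = 2 * s + 2" "s + t + 2 = ?L"
      using 2 by simp_all
    then have "b ^ ?L = b ^ (2 * N + t) + b ^ (2 * s + t + 1) - b ^ (2 * N + 2 * s)"
      using eq by (simp only:)
    moreover have "b ^ Suc ?L dvd \<dots>"
      using 2 s s2 t N by (intro dvd_add dvd_diff dvd) auto
    ultimately show False
      using ndvd[of ?L] by metis
  next
    case 3
    let ?L = "2 * s + 2"
    have "b ^ ?L = b ^ (2 * N + 2 * s) - b ^ (2 * N + t) + b ^ (s + t + 2) + b ^ (s + t + 1) - b ^ (2 * s + t + 1)"
      using eq by simp
    moreover have "b ^ Suc ?L dvd \<dots>"
      using 3 s s2 t N by (intro dvd_add dvd_diff dvd) auto
    ultimately show False
      using ndvd[of ?L] by metis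
  qed
qed

text \<open>Only numerical data of the scheme are kept. \<open>p_rec\<close> is
  \<open>\<Theta> P = P L\<close>; nothing is assumed about the order of the eigenvalues
  \<open>\<theta>\<close>, and \<open>\<phi>\<close> lists the values in the order to be
  established.\<close>

locale hermitian_eigenmatrix =
  fixes q N :: nat and n :: complex and p :: "nat \<Rightarrow> nat \<Rightarrow> complex"
  fixes B M :: complex and a b c \<theta> \<phi> :: "nat \<Rightarrow> complex"
  assumes B_def: "B = - of_nat q" and M_def: "M = B ^ (2 * N)"
    and c_def: "c = (\<lambda>i. B ^ (i - 1) * (1 - B ^ i))" and b_def: "b = (\<lambda>i. M - B ^ (2 * i))"
    and a_def: "a = (\<lambda>i. M - 1 - b i - c i)"
    and \<theta>_def: "\<theta> = (\<lambda>i. c 1 * p i 1)" and \<phi>_def: "\<phi> = (\<lambda>i. M / B ^ i - 1)"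
    and q: "q > 1" and N: "N > 2" and n: "n \<noteq> 0"
    and p_0: "i \<le> N \<Longrightarrow> p i 0 = 1"
    and p_rec: "i \<le> N \<Longrightarrow> j \<le> N \<Longrightarrow> \<theta> i * p i j = (\<Sum>k\<le>N. p i k * tridiag c a b k j)"
    and p_square: "i \<le> N \<Longrightarrow> j \<le> N \<Longrightarrow> (\<Sum>k\<le>N. p i k * p k j) = (if i = j then n else 0)"
begin

lemma norm_B: "norm B = of_nat q"
  by (simp add: B_def)

lemma B_nz [simp]: "B \<noteq> 0"
  using q by (simp add: B_def)

lemma B_power_inject: "B ^ i = B ^ j \<longleftrightarrow> i = j"
proof
  assume "B ^ i = B ^ j"
  then have "real q ^ i = real q ^ j"
    by (metis norm_B norm_power)
  then show "i = j"
    using q by simp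
qed simp

lemma boundary: "c 0 = 0" "b N = 0" "a 0 = 0"
  by (simp_all add: c_def b_def a_def M_def)

lemma b_nonzero: "i < N \<Longrightarrow> b i \<noteq> 0"
  using B_power_inject[of "2 * N" "2 * i"] by (simp add: b_def M_def)

lemma c_nonzero: "i > 0 \<Longrightarrow> c i \<noteq> 0"
  using B_power_inject[of i 0] by (simp add: c_def)

lemma row_sum:
  "k \<le> N \<Longrightarrow> (\<Sum>j\<le>N. tridiag c a b k j * f j) = c k * f (k - 1) + a k * f k + b k * f (Suc k)"
  by (rule sum_tridiag_row) (use boundary in auto)

text \<open>\<open>P \<Theta> P = P P L = n L\<close>, and another factor \<open>P\<close> on the
  right gives \<open>P \<Theta> = L P\<close>. This recurrence runs over the rows and so constrains
  the order of the idempotents.\<close>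

lemma p_dual:
  assumes ij: "i \<le> N" "j \<le> N"
  shows "p i j * \<theta> j = c i * p (i - 1) j + a i * p i j + b i * p (Suc i) j"
proof -
  have PTP: "(\<Sum>l\<le>N. p i l * \<theta> l * p l k) = n * tridiag c a b i k" if k: "k \<le> N" for k
  proof -
    have "(\<Sum>l\<le>N. p i l * \<theta> l * p l k) = (\<Sum>l\<le>N. \<Sum>m\<le>N. p i l * p l m * tridiag c a b m k)"
      using k by (intro sum.cong refl) (simp add: p_rec mult.assoc sum_distrib_left)
    also have "\<dots> = (\<Sum>m\<le>N. (\<Sum>l\<le>N. p i l * p l m) * tridiag c a b m k)"
      by (subst sum.swap) (simp add: sum_distrib_right)
    also have "\<dots> = (\<Sum>m\<le>N. if m = i then n * tridiag c a b i k else 0)"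
      using ij by (intro sum.cong) (auto simp: p_square)
    finally show ?thesis
      using ij by simp
  qed
  have "n * (p i j * \<theta> j) = (\<Sum>l\<le>N. if l = j then p i j * \<theta> j * n else 0)"
    using ij by simp
  also have "\<dots> = (\<Sum>l\<le>N. p i l * \<theta> l * (\<Sum>k\<le>N. p l k * p k j))"
    using ij by (intro sum.cong) (auto simp: p_square)
  also have "\<dots> = (\<Sum>k\<le>N. (\<Sum>l\<le>N. p i l * \<theta> l * p l k) * p k j)"
    by (simp add: sum_distrib_left sum_distrib_right mult.assoc, rule sum.swap)
  also have "\<dots> = (\<Sum>k\<le>N. n * tridiag c a b i k * p k j)"
    by (intro sum.cong refl) (simp only: PTP atMost_iff)
  also have "\<dots> = n * (\<Sum>k\<le>N. tridiag c a b i k * p k j)"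
    by (simp only: sum_distrib_left mult.assoc)
  finally show ?thesis
    using n row_sum[OF ij(1), of "\<lambda>k. p k j"] by simp
qed

lemma theta_0: "\<theta> 0 = \<phi> 0"
  using p_dual[of 0 0] p_0[of 0] p_0[of 1] N by (simp add: boundary \<phi>_def a_def)

lemma theta_rec:
  assumes "i \<le> N"
  shows "\<theta> i * \<theta> 1 = c i * \<theta> (i - 1) + a i * \<theta> i + b i * \<theta> (Suc i)"
  using p_dual[OF assms, of 1] N by (simp add: \<theta>_def algebra_simps)

lemma p_rec_Suc:
  assumes "i \<le> N" "Suc j \<le> N"
  shows "c (Suc j) * p i (Suc j) = \<theta> i * p i j - a j * p i j - (if j = 0 then 0 else b (j - 1) * p i (j - 1))"
  using p_rec[of i j] assms sum_tridiag_col[of j N c a b "p i"]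
  by (simp add: algebra_simps)

text \<open>The recurrence determines a row from its eigenvalue and the initial entry
  \<open>1\<close>, and \<open>P^2 = n I\<close> excludes equal rows.\<close>

lemma theta_inject:
  assumes ij: "i \<le> N" "j \<le> N" and eq: "\<theta> i = \<theta> j"
  shows "i = j"
proof -
  have rows: "p i k = p j k" if "k \<le> N" for k
    using that
  proof (induction k rule: less_induct)
    case (less k)
    show ?case
    proof (cases k)
      case 0
      then show ?thesis
        using ij p_0 by simp
    next
      case (Suc l)
      have "c k * p i k = c k * p j k"
        using p_rec_Suc[OF ij(1), of l] p_rec_Suc[OF ij(2), of l] less eq Suc by simp
      then show ?thesis
        using c_nonzero[of k] Suc by simp
    qed
  qed
  have "(\<Sum>k\<le>N. p i k * p k i) = (\<Sum>k\<le>N. p j k * p k i)"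
    using rows by simp
  then show ?thesis
    using p_square[of i i] p_square[of j i] ij n by (auto split: if_splits)
qed

text \<open>On the functions \<open>k \<mapsto> B\<^bsup>-mk\<^esup>\<close> the tridiagonal matrix acts triangularly, with diagonal
  \<open>\<phi> m\<close>. Hence the moments of a row of the eigenmatrix against these functions all vanish unless its
  eigenvalue is some \<open>\<phi> m\<close>.\<close>

definition moment :: "nat \<Rightarrow> nat \<Rightarrow> complex" where
  "moment i m = (\<Sum>j\<le>N. p i j * (1 / B ^ j) ^ m)"

lemma power_double: "B ^ (2 * k) = (B ^ k)\<^sup>2"
  by (simp add: power_mult mult.commute)

text \<open>The factors \<open>B ^ k\<close> and \<open>B ^ (2 * k)\<close> lower the exponent
  \<open>m\<close> by one and by two. The coefficient of the former vanishes at
  \<open>m = 0\<close>, that of the latter at \<open>m = 0\<close> and \<open>m = 1\<close>, so no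
  negative exponent arises.\<close>

lemma tridiag_power:
  assumes "k \<le> N"
  shows "(\<Sum>j\<le>N. tridiag c a b k j * (1 / B ^ j) ^ m) =
    (1 / B ^ k) ^ m * (\<phi> m + B ^ k * (B ^ m / B - 1 / B) + B ^ (2 * k) * (1 + 1 / B - B ^ m / B - 1 / B ^ m))"
proof -
  have c: "c k * (1 / B ^ (k - 1)) ^ m = (1 / B ^ k) ^ m * (B ^ m * (B ^ k * (1 - B ^ k) / B))"
  proof (cases k)
    case (Suc l)
    then show ?thesis
      by (simp add: c_def power_mult_distrib power_one_over field_simps)
  qed (simp add: boundary)
  have c': "c k = B ^ k * (1 - B ^ k) / B"
    by (cases k) (simp_all add: c_def)
  have b: "b k * (1 / B ^ Suc k) ^ m = (1 / B ^ k) ^ m * ((M - B ^ (2 * k)) / B ^ m)"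
    by (simp add: b_def power_mult_distrib power_one_over field_simps)
  have "(\<Sum>j\<le>N. tridiag c a b k j * (1 / B ^ j) ^ m) =
    (1 / B ^ k) ^ m * (B ^ m * (B ^ k * (1 - B ^ k) / B) + a k + (M - B ^ (2 * k)) / B ^ m)"
    unfolding row_sum[OF assms] b c by (simp only: distrib_left mult.commute[of "a k"])
  also have "B ^ m * (B ^ k * (1 - B ^ k) / B) + a k + (M - B ^ (2 * k)) / B ^ m =
    \<phi> m + B ^ k * (B ^ m / B - 1 / B) + B ^ (2 * k) * (1 + 1 / B - B ^ m / B - 1 / B ^ m)"
    unfolding a_def c' b_def \<phi>_def power_double by (simp add: field_simps power2_eq_square)
  finally show ?thesis .
qed

lemma moment_rec:
  assumes "i \<le> N"
  shows "(\<theta> i - \<phi> m) * moment i m =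
    (\<Sum>k\<le>N. p i k * ((1 / B ^ k) ^ m * (B ^ k * (B ^ m / B - 1 / B)))) +
    (\<Sum>k\<le>N. p i k * ((1 / B ^ k) ^ m * (B ^ (2 * k) * (1 + 1 / B - B ^ m / B - 1 / B ^ m))))"
proof -
  have "\<theta> i * moment i m = (\<Sum>j\<le>N. \<Sum>k\<le>N. p i k * (tridiag c a b k j * (1 / B ^ j) ^ m))"
    unfolding moment_def sum_distrib_left
    using p_rec[OF assms] by (intro sum.cong refl) (simp add: mult.assoc[symmetric] sum_distrib_right)
  also have "\<dots> = (\<Sum>k\<le>N. p i k * (\<Sum>j\<le>N. tridiag c a b k j * (1 / B ^ j) ^ m))"
    by (subst sum.swap) (simp add: sum_distrib_left)
  also have "\<dots> = (\<Sum>k\<le>N. p i k * ((1 / B ^ k) ^ m *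
      (\<phi> m + B ^ k * (B ^ m / B - 1 / B) + B ^ (2 * k) * (1 + 1 / B - B ^ m / B - 1 / B ^ m))))"
    by (intro sum.cong refl) (simp only: tridiag_power atMost_iff)
  also have "\<dots> = (\<Sum>k\<le>N. \<phi> m * (p i k * (1 / B ^ k) ^ m) +
      p i k * ((1 / B ^ k) ^ m * (B ^ k * (B ^ m / B - 1 / B))) +
      p i k * ((1 / B ^ k) ^ m * (B ^ (2 * k) * (1 + 1 / B - B ^ m / B - 1 / B ^ m))))"
    by (intro sum.cong refl) (simp only: distrib_left mult_ac)
  also have "\<dots> = \<phi> m * moment i m +
    (\<Sum>k\<le>N. p i k * ((1 / B ^ k) ^ m * (B ^ k * (B ^ m / B - 1 / B)))) +
    (\<Sum>k\<le>N. p i k * ((1 / B ^ k) ^ m * (B ^ (2 * k) * (1 + 1 / B - B ^ m / B - 1 / B ^ m))))"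
    by (simp only: sum.distrib moment_def sum_distrib_left)
  finally show ?thesis
    by (simp add: algebra_simps)
qed

lemma moment_eq_0:
  assumes i: "i \<le> N" and neq: "\<And>m. m \<le> N \<Longrightarrow> \<theta> i \<noteq> \<phi> m" and m: "m \<le> N"
  shows "moment i m = 0"
  using m
proof (induction m rule: less_induct)
  case (less m)
  have "(\<Sum>k\<le>N. p i k * ((1 / B ^ k) ^ m * (B ^ k * (B ^ m / B - 1 / B)))) = 0"
  proof (cases m)
    case (Suc l)
    then have "(\<Sum>k\<le>N. p i k * ((1 / B ^ k) ^ m * (B ^ k * (B ^ m / B - 1 / B)))) = moment i l * (B ^ m / B - 1 / B)"
      unfolding moment_def sum_distrib_right by (intro sum.cong) auto
    then show ?thesis
      using less Suc by simp
  qed simp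
  moreover have "(\<Sum>k\<le>N. p i k * ((1 / B ^ k) ^ m * (B ^ (2 * k) * (1 + 1 / B - B ^ m / B - 1 / B ^ m)))) = 0"
  proof (cases "m \<le> 1")
    case True
    then have "m = 0 \<or> m = 1"
      by auto
    then have "1 + 1 / B - B ^ m / B - 1 / B ^ m = 0"
      by auto
    then show ?thesis
      by simp
  next
    case False
    then obtain l where l: "m = Suc (Suc l)"
      by (metis One_nat_def Suc_le_eq not_less_eq_eq not0_implies_Suc le0 not_less)
    have "(1 / B ^ k) ^ m * B ^ (2 * k) = (1 / B ^ k) ^ l" for k
      by (simp add: l mult_2 power_add)
    then have "(\<Sum>k\<le>N. p i k * ((1 / B ^ k) ^ m * (B ^ (2 * k) * (1 + 1 / B - B ^ m / B - 1 / B ^ m)))) =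
      moment i l * (1 + 1 / B - B ^ m / B - 1 / B ^ m)"
      unfolding moment_def sum_distrib_right mult.assoc[symmetric] by (intro sum.cong) (auto simp: mult.assoc)
    then show ?thesis
      using less l by simp
  qed
  ultimately have "(\<theta> i - \<phi> m) * moment i m = 0"
    using moment_rec[OF i, of m] by simp
  then show ?case
    using neq[OF less.prems] by simp
qed

lemma theta_in_phi:
  assumes i: "i \<le> N"
  shows "\<exists>m\<le>N. \<theta> i = \<phi> m"
proof (rule ccontr)
  assume "\<not> ?thesis"
  then have zero: "moment i m = 0" if "m \<le> N" for m
    using moment_eq_0[OF i] that by blast
  \<comment> \<open>The roots are the points \<open>1 / B ^ j\<close> with
    \<open>1 \<le> j \<le> N\<close>, so testing a row against this polynomial leaves only the term
    \<open>j = 0\<close>. The degree \<open>N\<close> is within reach of the vanishing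
    moments.\<close>
  define L where "L = (\<Prod>j\<in>{1..N}. [:- (1 / B ^ j), 1:])"
  have deg: "Polynomial.degree L \<le> N"
    using degree_prod_sum_le[of "{1..N}" "\<lambda>j. [:- (1 / B ^ j), 1:]"] by (simp add: L_def)
  have "(\<Sum>j\<le>N. p i j * poly L (1 / B ^ j)) = (\<Sum>j\<le>N. \<Sum>m\<le>Polynomial.degree L. Polynomial.coeff L m * (p i j * (1 / B ^ j) ^ m))"
    by (simp add: poly_altdef sum_distrib_left mult_ac)
  also have "\<dots> = (\<Sum>m\<le>Polynomial.degree L. Polynomial.coeff L m * moment i m)"
    unfolding moment_def by (subst sum.swap) (simp add: sum_distrib_left)
  also have "\<dots> = 0"
    using zero deg by (intro sum.neutral) auto
  finally have "(\<Sum>j\<le>N. p i j * poly L (1 / B ^ j)) = 0" .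
  moreover have "poly L (1 / B ^ j) = 0" if "j \<le> N" "j \<noteq> 0" for j
    using that by (auto simp: L_def poly_prod intro!: bexI[of _ j])
  then have "(\<Sum>j\<le>N. p i j * poly L (1 / B ^ j)) = (\<Sum>j\<le>N. if j = 0 then poly L 1 else 0)"
    using p_0[OF i] by (intro sum.cong) auto
  moreover have "poly L 1 \<noteq> 0"
    using B_power_inject[of _ 0] by (auto simp: L_def poly_prod field_simps)
  ultimately show False
    by simp
qed

lemma c_1: "c 1 = 1 - B" and a_1: "a 1 = B ^ 2 + B - 2" and b_1: "b 1 = M - B ^ 2"
  by (simp_all add: a_def b_def c_def)

text \<open>With \<open>\<theta> 1 = \<phi> s\<close> and \<open>\<theta> 2 = \<phi> t\<close>, row
  \<open>1\<close> of the dual recurrence becomes, after clearing denominators and cancelling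
  \<open>M\<close>, an equation between powers of \<open>-q\<close>. Distinctness of the eigenvalues
  supplies \<open>s \<noteq> 0\<close> and \<open>t \<noteq> s\<close>.\<close>

lemma theta_1: "\<theta> 1 = \<phi> 1"
proof -
  obtain s t where st: "s \<le> N" "\<theta> 1 = \<phi> s" "t \<le> N" "\<theta> 2 = \<phi> t"
    using theta_in_phi[of 1] theta_in_phi[of 2] N by auto
  have s: "s \<noteq> 0"
    using st(2) theta_0 theta_inject[of 1 0] N by (intro notI) simp
  have ts: "t \<noteq> s"
    using st(2,4) theta_inject[of 1 2] N by (intro notI) simp
  have M: "M \<noteq> 0"
    by (simp add: M_def)
  have "\<phi> s ^ 2 = c 1 * \<phi> 0 + a 1 * \<phi> s + b 1 * \<phi> t"
    using theta_rec[of 1] N st theta_0 by (simp add: power2_eq_square numeral_2_eq_2)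
  define u v where "u = B ^ s" and "v = B ^ t"
  have uv: "u \<noteq> 0" "v \<noteq> 0"
    by (simp_all add: u_def v_def)
  have "(M / u - 1) ^ 2 = (1 - B) * (M - 1) + (B ^ 2 + B - 2) * (M / u - 1) + (M - B ^ 2) * (M / v - 1)"
    using \<open>\<phi> s ^ 2 = _\<close> unfolding c_1 a_1 b_1 by (simp add: \<phi>_def u_def v_def)
  moreover have "M * (M * u ^ 2 - B ^ 2 * u ^ 2) - M * (M * v - B ^ 2 * u * v - B * u * v + B * u ^ 2 * v) =
      ((1 - B) * (M - 1) + (B ^ 2 + B - 2) * (M / u - 1) + (M - B ^ 2) * (M / v - 1) - (M / u - 1) ^ 2) * (u ^ 2 * v)"
    using uv by (simp add: field_simps power2_eq_square)
  ultimately have "M * (M * u ^ 2 - B ^ 2 * u ^ 2) = M * (M * v - B ^ 2 * u * v - B * u * v + B * u ^ 2 * v)"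
    by simp
  then have "M * u ^ 2 - B ^ 2 * u ^ 2 = M * v - B ^ 2 * u * v - B * u * v + B * u ^ 2 * v"
    using M by simp
  then have "B ^ (2 * N + 2 * s) - B ^ (2 * s + 2) =
      B ^ (2 * N + t) - B ^ (s + t + 2) - B ^ (s + t + 1) + B ^ (2 * s + t + 1)"
    by (simp add: M_def u_def v_def power_add power_mult power2_eq_square mult_ac power_mult_distrib)
  moreover have "B = of_int (- int q)"
    by (simp add: B_def)
  ultimately have "(of_int ((- int q) ^ (2 * N + 2 * s) - (- int q) ^ (2 * s + 2)) :: complex) =
      of_int ((- int q) ^ (2 * N + t) - (- int q) ^ (s + t + 2) - (- int q) ^ (s + t + 1) + (- int q) ^ (2 * s + t + 1))"
    by (simp only: of_int_diff of_int_add of_int_power)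
  then have "(- int q) ^ (2 * N + 2 * s) - (- int q) ^ (2 * s + 2) =
      (- int q) ^ (2 * N + t) - (- int q) ^ (s + t + 2) - (- int q) ^ (s + t + 1) + (- int q) ^ (2 * s + t + 1)"
    by (simp only: of_int_eq_iff)
  then have "s = 1"
    using integer_power_equation[of "- int q" s N t] q s st ts N by simp
  then show ?thesis
    using st by simp
qed

lemma phi_rec: "\<phi> i * \<phi> 1 = c i * \<phi> (i - 1) + a i * \<phi> i + b i * \<phi> (Suc i)"
proof -
  have c': "c i * \<phi> (i - 1) = B ^ i * (1 - B ^ i) / B * (M * B / B ^ i - 1)"
    by (cases i) (simp_all add: c_def \<phi>_def)
  have c'': "c i = B ^ i * (1 - B ^ i) / B"
    by (cases i) (simp_all add: c_def)
  show ?thesis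
    unfolding c' unfolding a_def c'' b_def \<phi>_def power_double by (simp add: field_simps power2_eq_square)
qed

text \<open>Both sequences satisfy the same three-term recurrence, and since
  \<open>b k \<noteq> 0\<close> below \<open>N\<close> it propagates the agreement at
  \<open>0\<close> and \<open>1\<close>.\<close>

lemma theta_eq_phi: "i \<le> N \<Longrightarrow> \<theta> i = \<phi> i"
proof (induction i rule: less_induct)
  case (less i)
  consider "i = 0" | "i = 1" | k where "i = Suc k" "k \<ge> 1"
    by (cases i) force+
  then show ?case
  proof cases
    case 3
    have "b k * \<theta> (Suc k) = b k * \<phi> (Suc k)"
      using theta_rec[of k] phi_rec[of k] less 3 theta_1 by (simp add: algebra_simps)
    then show ?thesis
      using b_nonzero[of k] less 3 by simp
  qed (use theta_0 theta_1 in auto)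
qed

end

section \<open>Diagonal matrices commuting with the tridiagonal matrix\<close>

text \<open>In the application \<open>\<tau> = t 1 / t 0\<close>,
  \<open>\<sigma> = t 2 / t 1\<close> and \<open>y = c N * t (N - 1) / t N\<close>.
  \<open>e1\<close>, \<open>e2\<close>, \<open>e3\<close> are the entries \<open>(1, 0)\<close>,
  \<open>(N, 0)\<close>, \<open>(N, 1)\<close> of the commutation for \<open>T\<close>, and
  \<open>e1'\<close> is the entry \<open>(1, 0)\<close> for its inverse. Eliminating
  \<open>y\<close> and \<open>\<sigma>\<close> leaves a linear condition on
  \<open>z = \<tau> + r\<close>. Multiplying \<open>e1\<close> by \<open>e1'\<close> removes
  \<open>\<sigma>\<close> and \<open>\<sigma>'\<close> and is symmetric in \<open>\<tau>\<close> and
  \<open>r\<close>, so it gives a quadratic condition on the same \<open>z\<close>.\<close>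

lemma elimination_identity:
  fixes b m \<tau> r \<sigma> \<sigma>' y a :: complex
  assumes rec: "\<tau> * r = 1" "\<sigma> * \<sigma>' = 1" and nz: "b \<noteq> 0" "b \<noteq> 1" "m \<noteq> 0" "m \<noteq> 1"
    and e1: "\<tau> * (m\<^sup>2 / b - 1) = (1 - b) * r + (b\<^sup>2 + b - 2) + (m\<^sup>2 - b\<^sup>2) * \<sigma>"
    and e1': "r * (m\<^sup>2 / b - 1) = (1 - b) * \<tau> + (b\<^sup>2 + b - 2) + (m\<^sup>2 - b\<^sup>2) * \<sigma>'"
    and e2: "\<tau> * (m - 1) = y + a"
    and e3: "(1 - b) * (m\<^sup>2 - 1) * r + (b\<^sup>2 + b - 2) * (m - 1) +
      ((m - 1)\<^sup>2 - (1 - b) * (m\<^sup>2 - 1) - (b\<^sup>2 + b - 2) * (m - 1)) * \<sigma> = y * (b * m - 1) + a * (m - 1)"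
    and a: "a = m\<^sup>2 - 1 - m / b * (1 - m)"
  shows "(b + 1) * (m - b\<^sup>2) * (m\<^sup>2 - b\<^sup>2)\<^sup>2 = 0"
proof -
  define z where "z = \<tau> + r"
  define k where "k = m\<^sup>2 - b"
  define w where "w = m\<^sup>2 * (b + 1) + b * m * (b + 2) + 2 * b * (b + 1)"
  have f1: "\<tau> * k = b * (1 - b) * r + b * (b\<^sup>2 + b - 2) + b * (m\<^sup>2 - b\<^sup>2) * \<sigma>"
  proof -
    have "\<tau> * k = b * (\<tau> * (m\<^sup>2 / b - 1))"
      using nz by (simp add: k_def field_simps)
    then show ?thesis
      unfolding e1 by (simp add: algebra_simps)
  qed
  have f1': "r * k = b * (1 - b) * \<tau> + b * (b\<^sup>2 + b - 2) + b * (m\<^sup>2 - b\<^sup>2) * \<sigma>'"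
  proof -
    have "r * k = b * (r * (m\<^sup>2 / b - 1))"
      using nz by (simp add: k_def field_simps)
    then show ?thesis
      unfolding e1' by (simp add: algebra_simps)
  qed
  have ba: "b * a = b * (m\<^sup>2 - 1) - m * (1 - m)"
    using nz by (simp add: a field_simps)
  have "(1 - b) * (m\<^sup>2 - 1) * r + (b\<^sup>2 + b - 2) * (m - 1) + (m - 1) * b * (m - b) * \<sigma> =
      \<tau> * (m - 1) * (b * m - 1) + a * (m - b * m)"
    using e2 e3 by Groebner_Basis.algebra
  then have "(m - 1) * ((b - 1) * (m * (b * (m + b + 1) * z - w))) = 0"
    using f1 ba unfolding z_def k_def w_def by Groebner_Basis.algebra
  then have bz: "b * (m + b + 1) * z = w"
    using nz by simp
  have "b\<^sup>2 * (m\<^sup>2 - b\<^sup>2)\<^sup>2 = (\<tau> * k - b * (1 - b) * r - b * (b\<^sup>2 + b - 2)) * (r * k - b * (1 - b) * \<tau> - b * (b\<^sup>2 + b - 2))"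
    using f1 f1' rec(2) by Groebner_Basis.algebra
  also have "\<dots> = k\<^sup>2 + b\<^sup>2 * (b\<^sup>2 + b - 2)\<^sup>2 + b\<^sup>2 * (1 - b)\<^sup>2 + 2 * b * k * (1 - b) +
      b * (b\<^sup>2 + b - 2) * (b * (1 - b) - k) * z - b * k * (1 - b) * z\<^sup>2"
    using rec(1) unfolding z_def by Groebner_Basis.algebra
  finally have "(b - 1) * (m * ((b + 1) * (m - b\<^sup>2) * (m\<^sup>2 - b\<^sup>2)\<^sup>2)) = 0"
    using bz unfolding k_def w_def by Groebner_Basis.algebra
  then show ?thesis
    using nz by simp
qed

context hermitian_eigenmatrix
begin

text \<open>Column \<open>0\<close> of \<open>P\<close> is constant, so column \<open>0\<close> of
  \<open>T P T\<close> is a multiple of the diagonal of \<open>T\<close>; column \<open>0\<close> of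
  \<open>L\<close> has \<open>c 1\<close> as its only nonzero entry. Hence no entry of
  \<open>P\<close> besides \<open>\<theta> i\<close> remains.\<close>

lemma commuting_col_0:
  assumes comm: "\<And>i j. i \<le> N \<Longrightarrow> j \<le> N \<Longrightarrow>
      (\<Sum>k\<le>N. t i * p i k * t k * tridiag c a b k j) = (\<Sum>k\<le>N. tridiag c a b i k * (t k * p k j * t j))"
    and i: "i \<le> N"
  shows "t i * t 1 * \<theta> i = t 0 * (c i * t (i - 1) + a i * t i + b i * t (Suc i))"
proof -
  have "(\<Sum>k\<le>N. t i * p i k * t k * tridiag c a b k 0) = t i * t 1 * \<theta> i"
    using sum_tridiag_col[of 0 N c a b "\<lambda>k. t i * p i k * t k"] N
    by (simp add: boundary \<theta>_def mult_ac)
  moreover have "(\<Sum>k\<le>N. tridiag c a b i k * (t k * p k 0 * t 0)) = (\<Sum>k\<le>N. tridiag c a b i k * t k) * t 0"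
    unfolding sum_distrib_right by (intro sum.cong refl) (simp add: p_0)
  ultimately show ?thesis
    using comm[OF i, of 0] row_sum[OF i, of t] by (simp add: mult_ac)
qed

text \<open>The entry \<open>p i 2\<close> is expressed through \<open>\<theta> i\<close> by the
  recurrence, and multiplying by \<open>c 1\<close> turns \<open>p i 1\<close> into
  \<open>\<theta> i\<close>.\<close>

lemma commuting_col_1:
  assumes comm: "\<And>i j. i \<le> N \<Longrightarrow> j \<le> N \<Longrightarrow>
      (\<Sum>k\<le>N. t i * p i k * t k * tridiag c a b k j) = (\<Sum>k\<le>N. tridiag c a b i k * (t k * p k j * t j))"
    and i: "i \<le> N"
  shows "t i * (c 1 * b 0 * t 0 + a 1 * t 1 * \<theta> i + (\<theta> i ^ 2 - c 1 * b 0 - a 1 * \<theta> i) * t 2) =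
    t 1 * (c i * t (i - 1) * \<theta> (i - 1) + a i * t i * \<theta> i + b i * t (Suc i) * \<theta> (Suc i))"
proof -
  have "(\<Sum>k\<le>N. t i * p i k * t k * tridiag c a b k 1) =
      t i * (b 0 * t 0 + a 1 * t 1 * p i 1 + (\<theta> i * p i 1 - b 0 - a 1 * p i 1) * t 2)"
  proof -
    have c2: "\<theta> i * p i 1 - b 0 - a 1 * p i 1 = c 2 * p i 2"
      using p_rec_Suc[OF i, of 1] p_0[OF i] N by (simp add: numeral_2_eq_2)
    show ?thesis
      unfolding c2 using sum_tridiag_col[of 1 N c a b "\<lambda>k. t i * p i k * t k"] N p_0[OF i]
      by (simp add: numeral_2_eq_2 algebra_simps)
  qed
  moreover have "(\<Sum>k\<le>N. tridiag c a b i k * (t k * p k 1 * t 1)) =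
      t 1 * (c i * t (i - 1) * p (i - 1) 1 + a i * t i * p i 1 + b i * t (Suc i) * p (Suc i) 1)"
    using row_sum[OF i, of "\<lambda>k. t k * p k 1 * t 1"] by (simp add: algebra_simps)
  ultimately have "t i * (b 0 * t 0 + a 1 * t 1 * p i 1 + (\<theta> i * p i 1 - b 0 - a 1 * p i 1) * t 2) =
      t 1 * (c i * t (i - 1) * p (i - 1) 1 + a i * t i * p i 1 + b i * t (Suc i) * p (Suc i) 1)"
    using comm[OF i, of 1] N by simp
  from arg_cong[OF this, of "\<lambda>x. c 1 * x"] show ?thesis
    by (simp add: \<theta>_def algebra_simps power2_eq_square)
qed

text \<open>Row \<open>1\<close> in column \<open>0\<close> involves only \<open>t 0\<close>,
  \<open>t 1\<close>, \<open>t 2\<close>. Because \<open>b N = 0\<close>, row \<open>N\<close> adds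
  only \<open>t (N - 1)\<close> and \<open>t N\<close>, and comparing its columns \<open>0\<close>
  and \<open>1\<close> removes the former.\<close>

lemma no_commuting_diagonal:
  assumes t: "\<And>i. i \<le> N \<Longrightarrow> t i \<noteq> 0"
    and comm: "\<And>i j. i \<le> N \<Longrightarrow> j \<le> N \<Longrightarrow>
      (\<Sum>k\<le>N. t i * p i k * t k * tridiag c a b k j) = (\<Sum>k\<le>N. tridiag c a b i k * (t k * p k j * t j))"
    and comm': "\<And>i j. i \<le> N \<Longrightarrow> j \<le> N \<Longrightarrow>
      (\<Sum>k\<le>N. inverse (t i) * p i k * inverse (t k) * tridiag c a b k j) =
      (\<Sum>k\<le>N. tridiag c a b i k * (inverse (t k) * p k j * inverse (t j)))"
  shows False
proof -
  define m where "m = B ^ N"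
  have M: "M = m\<^sup>2"
    by (simp add: M_def m_def power_double)
  have tnz: "t 0 \<noteq> 0" "t 1 \<noteq> 0" "t 2 \<noteq> 0" "t N \<noteq> 0"
    using t N by auto
  have th: "\<theta> 1 = m\<^sup>2 / B - 1" "\<theta> N = m - 1" "\<theta> (N - 1) = B * m - 1"
  proof -
    show "\<theta> 1 = m\<^sup>2 / B - 1"
      using N by (simp add: theta_eq_phi \<phi>_def M)
    show "\<theta> N = m - 1"
      by (simp add: theta_eq_phi \<phi>_def M power2_eq_square m_def)
    have "m = B * B ^ (N - 1)"
      using N by (simp add: m_def power_eq_if)
    then show "\<theta> (N - 1) = B * m - 1"
      by (simp add: theta_eq_phi \<phi>_def M power2_eq_square)
  qed
  have b0: "b 0 = m\<^sup>2 - 1"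
    by (simp add: b_def M)
  have b1: "b 1 = m\<^sup>2 - B\<^sup>2"
    using b_1 by (simp add: M)
  have cN: "c N = m / B * (1 - m)"
  proof -
    have "m = B * B ^ (N - 1)"
      using N by (simp add: m_def power_eq_if)
    then show ?thesis
      by (simp add: c_def m_def[symmetric])
  qed
  have aN: "a N = m\<^sup>2 - 1 - m / B * (1 - m)"
    using boundary cN by (simp add: a_def M)
  have "t 1 * t 1 * \<theta> 1 = t 0 * (c 1 * t 0 + a 1 * t 1 + b 1 * t 2)"
    using commuting_col_0[OF comm, of 1] N by (simp add: numeral_2_eq_2)
  then have e1: "t 1 / t 0 * \<theta> 1 = c 1 * (t 0 / t 1) + a 1 + b 1 * (t 2 / t 1)"
    using tnz by (simp add: field_simps)
  have "inverse (t 1) * inverse (t 1) * \<theta> 1 =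
      inverse (t 0) * (c 1 * inverse (t 0) + a 1 * inverse (t 1) + b 1 * inverse (t 2))"
    using commuting_col_0[of "\<lambda>i. inverse (t i)", OF comm', of 1] N by (simp add: numeral_2_eq_2)
  then have e1': "t 0 / t 1 * \<theta> 1 = c 1 * (t 1 / t 0) + a 1 + b 1 * (t 1 / t 2)"
    using tnz by (simp add: field_simps)
  have "t N * t 1 * \<theta> N = t 0 * (c N * t (N - 1) + a N * t N)"
    using commuting_col_0[OF comm, of N] boundary by simp
  then have e2: "t 1 / t 0 * \<theta> N = c N * t (N - 1) / t N + a N"
    using tnz by (simp add: field_simps)
  have "t N * (c 1 * b 0 * t 0 + a 1 * t 1 * \<theta> N + (\<theta> N ^ 2 - c 1 * b 0 - a 1 * \<theta> N) * t 2) =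
    t 1 * (c N * t (N - 1) * \<theta> (N - 1) + a N * t N * \<theta> N)"
    using commuting_col_1[OF comm, of N] boundary by simp
  moreover have "x / t 1 = y / t N" if "t N * x = t 1 * y" for x y
    using that tnz by (simp add: frac_eq_eq mult.commute)
  ultimately have "(c 1 * b 0 * t 0 + a 1 * t 1 * \<theta> N + (\<theta> N ^ 2 - c 1 * b 0 - a 1 * \<theta> N) * t 2) / t 1 =
      (c N * t (N - 1) * \<theta> (N - 1) + a N * t N * \<theta> N) / t N"
    by blast
  then have e3: "c 1 * b 0 * (t 0 / t 1) + a 1 * \<theta> N + (\<theta> N ^ 2 - c 1 * b 0 - a 1 * \<theta> N) * (t 2 / t 1) =
    c N * t (N - 1) / t N * \<theta> (N - 1) + a N * \<theta> N"
    using tnz by (simp add: add_divide_distrib)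
  have inj: "m \<noteq> 1" "m \<noteq> B\<^sup>2" "m\<^sup>2 \<noteq> B\<^sup>2" "B \<noteq> 1" "m \<noteq> 0"
    using B_power_inject[of N 0] B_power_inject[of N 2] B_power_inject[of "2 * N" 2] B_power_inject[of 1 0] N
    by (simp_all add: m_def power_double)
  have "(B + 1) * (m - B\<^sup>2) * (m\<^sup>2 - B\<^sup>2)\<^sup>2 = 0"
    by (rule elimination_identity[of "t 1 / t 0" "t 0 / t 1" "t 2 / t 1" "t 1 / t 2" B m "c N * t (N - 1) / t N" "a N",
          OF _ _ B_nz inj(4,5,1) e1[unfolded th c_1 a_1 b1] e1'[unfolded th c_1 a_1 b1] e2[unfolded th]
            e3[unfolded th c_1 a_1 b0] aN])
      (use tnz in simp_all)
  moreover have "B + 1 \<noteq> 0"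
  proof
    assume "B + 1 = 0"
    then have "norm B = norm (- 1 :: complex)"
      by (metis add_eq_0_iff2)
    then show False
      using q by (simp add: norm_B)
  qed
  ultimately show False
    using inj by simp
qed

end

text \<open>In the application \<open>D\<close> is \<open>\<Theta>\<close>, \<open>U\<close> is the
  inverse of \<open>T\<close>, and \<open>B\<close> is the tridiagonal matrix, not
  \<open>-q\<close>. \<open>K = P T P\<close> commutes with \<open>B\<close> because
  \<open>T\<close> commutes with \<open>D\<close> and \<open>P\<close> interchanges \<open>D\<close>
  and \<open>B\<close>. The cube is \<open>K\<close> times \<open>T P T\<close>, so
  \<open>T P T\<close> is the inverse of \<open>K\<close>; and
  \<open>T P T U P U = T P P U = s I\<close> makes \<open>U P U\<close> a multiple of
  \<open>K\<close>.\<close>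

lemma commute_if_cube_eq_one:
  fixes P T U B D :: "'c::field mat"
  assumes carr [simp]: "P \<in> carrier_mat n n" "T \<in> carrier_mat n n" "U \<in> carrier_mat n n"
      "B \<in> carrier_mat n n" "D \<in> carrier_mat n n"
    and PD: "P * D = B * P" and DP: "D * P = P * B" and TD: "T * D = D * T" and TU: "T * U = 1\<^sub>m n"
    and PP: "P * P = s \<cdot>\<^sub>m 1\<^sub>m n" and cube: "(P * T) ^\<^sub>m 3 = 1\<^sub>m n"
  shows "(T * P * T) * B = B * (T * P * T)" "(U * P * U) * B = B * (U * P * U)"
proof -
  note assoc = assoc_mult_mat[of _ n n _ n _ n]
  have [simp]: "X * Y \<in> carrier_mat n n" if "X \<in> carrier_mat n n" "Y \<in> carrier_mat n n" for X Y :: "'c mat"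
    using that by (rule mult_carrier_mat)
  note [simp] = right_mult_one_mat[of _ n n] left_mult_one_mat[of _ n n]
  define G K where "G = T * P * T" and "K = P * T * P"
  have GK [simp]: "G \<in> carrier_mat n n" "K \<in> carrier_mat n n"
    by (simp_all add: G_def K_def)
  have "K * G = (P * T) ^\<^sub>m 3"
    by (simp add: G_def K_def numeral_3_eq_3 assoc)
  then have KG1: "K * G = 1\<^sub>m n"
    using cube by simp
  then have GK1: "G * K = 1\<^sub>m n"
    using mat_mult_left_right_inverse[of K n G] by simp
  have "K * B = P * (T * D) * P"
    by (simp add: K_def assoc flip: DP)
  also have "\<dots> = (P * D) * T * P"
    by (simp add: TD assoc)
  also have "\<dots> = B * K"
    by (simp add: PD K_def assoc)
  finally have KB: "K * B = B * K" .
  have "G * B = G * (B * K) * G"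
    using KG1 by (simp add: assoc)
  also have "\<dots> = (G * K) * B * G"
    by (simp add: assoc flip: KB)
  also have "\<dots> = B * G"
    using GK1 by simp
  finally show "(T * P * T) * B = B * (T * P * T)"
    by (simp add: G_def)
  have "G * (U * P * U) = T * (P * (T * U * P)) * U"
    by (simp add: G_def assoc)
  also have "\<dots> = s \<cdot>\<^sub>m (T * U)"
    by (simp add: TU PP mult_smult_distrib[of _ n n _ n] mult_smult_assoc_mat[of _ n n _ n])
  finally have "G * (U * P * U) = s \<cdot>\<^sub>m 1\<^sub>m n"
    by (simp add: TU)
  then have "K * (G * (U * P * U)) = s \<cdot>\<^sub>m K"
    by (simp add: mult_smult_distrib[of _ n n _ n])
  moreover have "K * (G * (U * P * U)) = (K * G) * (U * P * U)"
    by (simp add: assoc)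
  ultimately have "U * P * U = s \<cdot>\<^sub>m K"
    using KG1 by simp
  then show "(U * P * U) * B = B * (U * P * U)"
    using KB by (simp add: mult_smult_distrib[of _ n n _ n] mult_smult_assoc_mat[of _ n n _ n])
qed

context hermitian_eigenmatrix
begin

theorem no_diagonal_cube_root:
  assumes P: "P \<in> carrier_mat (N + 1) (N + 1)" "\<And>i j. i \<le> N \<Longrightarrow> j \<le> N \<Longrightarrow> P $$ (i, j) = p i j"
    and T: "T \<in> carrier_mat (N + 1) (N + 1)" "diagonal_mat T"
  shows "(P * T) ^\<^sub>m 3 \<noteq> 1\<^sub>m (N + 1)"
proof
  assume cube: "(P * T) ^\<^sub>m 3 = 1\<^sub>m (N + 1)"
  define t where "t i = T $$ (i, i)" for i
  let ?n = "N + 1"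
  let ?D = "mat_diag ?n \<theta>" and ?U = "mat_diag ?n (\<lambda>i. inverse (t i))"
    and ?B = "mat ?n ?n (\<lambda>(i, j). tridiag c a b i j)"
  have Td: "T = mat_diag ?n t"
    using T by (intro eq_matI) (auto simp: mat_diag_def t_def diagonal_mat_def)
  have ivl: "{0..<Suc N} = {..N}"
    by auto
  \<comment> \<open>The cube ends in the factor \<open>T\<close>, so a zero on the diagonal of
    \<open>T\<close> would give it a zero column.\<close>
  have t: "t i \<noteq> 0" if "i \<le> N" for i
  proof
    assume 0: "t i = 0"
    have "(P * T) ^\<^sub>m 3 = (P * T * (P * T) * P) * mat_diag ?n t"
      unfolding Td[symmetric] using P(1) T(1)
      by (simp add: numeral_3_eq_3 assoc_mult_mat[of _ ?n ?n _ ?n _ ?n])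
    also have "\<dots> = mat ?n ?n (\<lambda>(k, j). (P * T * (P * T) * P) $$ (k, j) * t j)"
      using P(1) T(1) by (intro mat_diag_mult_right[of _ ?n] mult_carrier_mat[of _ ?n ?n])
    finally have "1\<^sub>m ?n = mat ?n ?n (\<lambda>(k, j). (P * T * (P * T) * P) $$ (k, j) * t j)"
      using cube by simp
    then have "1\<^sub>m ?n $$ (i, i) = mat ?n ?n (\<lambda>(k, j). (P * T * (P * T) * P) $$ (k, j) * t j) $$ (i, i)"
      by (rule arg_cong)
    then show False
      using that 0 by simp
  qed
  have conj: "mat_diag ?n u * P * mat_diag ?n u = mat ?n ?n (\<lambda>(i, j). u i * p i j * u j)" for u
    unfolding mat_diag_mult_left[OF P(1)]
    by (subst mat_diag_mult_right[of _ ?n ?n]) (auto intro!: eq_matI simp: P(2))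
  have PD: "P * ?D = ?B * P"
    unfolding mat_diag_mult_right[OF P(1)]
  proof (rule eq_matI)
    fix i j assume "i < dim_row (?B * P)" "j < dim_col (?B * P)"
    then have ij: "i \<le> N" "j \<le> N"
      using P(1) by auto
    have "(?B * P) $$ (i, j) = (\<Sum>k\<le>N. tridiag c a b i k * p k j)"
      using P ij by (simp add: scalar_prod_def ivl del: sum.op_ivl_Suc)
    then show "mat ?n ?n (\<lambda>(i, j). P $$ (i, j) * \<theta> j) $$ (i, j) = (?B * P) $$ (i, j)"
      using p_dual[OF ij] row_sum[OF ij(1), of "\<lambda>k. p k j"] P(2)[OF ij] ij by simp
  qed (use P in auto)
  have DP: "?D * P = P * ?B"
    unfolding mat_diag_mult_left[OF P(1)]
  proof (rule eq_matI)
    fix i j assume "i < dim_row (P * ?B)" "j < dim_col (P * ?B)"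
    then have ij: "i \<le> N" "j \<le> N"
      using P(1) by auto
    have "(P * ?B) $$ (i, j) = (\<Sum>k\<le>N. p i k * tridiag c a b k j)"
      using P ij by (simp add: scalar_prod_def ivl del: sum.op_ivl_Suc)
    then show "mat ?n ?n (\<lambda>(i, j). \<theta> i * P $$ (i, j)) $$ (i, j) = (P * ?B) $$ (i, j)"
      using p_rec[OF ij] P(2)[OF ij] ij by simp
  qed (use P in auto)
  have TD: "T * ?D = ?D * T"
    by (simp add: Td mult.commute)
  have TU: "T * ?U = 1\<^sub>m ?n"
    unfolding Td mat_diag_diag using t by (auto simp: mat_diag_def intro!: eq_matI)
  have PP: "P * P = n \<cdot>\<^sub>m 1\<^sub>m ?n"
  proof (rule eq_matI)
    fix i j assume "i < dim_row (n \<cdot>\<^sub>m 1\<^sub>m ?n)" "j < dim_col (n \<cdot>\<^sub>m 1\<^sub>m ?n)"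
    then have ij: "i \<le> N" "j \<le> N"
      by auto
    have "(P * P) $$ (i, j) = (\<Sum>k\<le>N. p i k * p k j)"
      using P ij by (simp add: scalar_prod_def ivl del: sum.op_ivl_Suc)
    then show "(P * P) $$ (i, j) = (n \<cdot>\<^sub>m 1\<^sub>m ?n) $$ (i, j)"
      using p_square[OF ij] ij by simp
  qed (use P in auto)
  note commute = commute_if_cube_eq_one[OF P(1) T(1) _ _ _ PD DP TD TU PP cube]
  have entries: "(\<Sum>k\<le>N. u i * p i k * u k * tridiag c a b k j) = (\<Sum>k\<le>N. tridiag c a b i k * (u k * p k j * u j))"
    if eq: "mat_diag ?n u * P * mat_diag ?n u * ?B = ?B * (mat_diag ?n u * P * mat_diag ?n u)"
      and ij: "i \<le> N" "j \<le> N" for u i j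
  proof -
    have "(mat ?n ?n (\<lambda>(i, j). u i * p i j * u j) * ?B) $$ (i, j) = (?B * mat ?n ?n (\<lambda>(i, j). u i * p i j * u j)) $$ (i, j)"
      using eq unfolding conj by simp
    then show ?thesis
      using ij by (simp add: scalar_prod_def ivl del: sum.op_ivl_Suc)
  qed
  show False
    by (rule no_commuting_diagonal[of t], fact t; rule entries)
      (use commute(1)[unfolded Td] commute(2) in simp_all)
qed

end

section \<open>The Hermitian forms scheme\<close>

context hermitian_geometry
begin

lemma finite_H: "finite H"
proof (rule finite_subset)
  show "H \<subseteq> (\<lambda>f. mat N N f) ` ({..<N} \<times> {..<N} \<rightarrow>\<^sub>E UNIV)"
  proof
    fix A :: "'a mat" assume "A \<in> H"
    then have eq: "A = mat N N (restrict (($$) A) ({..<N} \<times> {..<N}))"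
      using H_carrier by (intro eq_matI) auto
    show "A \<in> (\<lambda>f. mat N N f) ` ({..<N} \<times> {..<N} \<rightarrow>\<^sub>E UNIV)"
      by (rule image_eqI[where f = "mat N N", OF eq]) simp
  qed
qed (simp add: finite_PiE)

lemma rk_minus_commute:
  assumes "A \<in> H" "B \<in> H"
  shows "rk (A - B) = rk (B - A)"
proof -
  have sub: "ker (C - D) \<subseteq> ker (D - C)" if "C \<in> H" "D \<in> H" for C D
  proof
    fix x assume x: "x \<in> ker (C - D)"
    have xV: "x \<in> V"
      using x ker_V by blast
    note dist = minus_mult_distrib_mat_vec[of _ N N _ x, OF H_carrier H_carrier xV]
    have "C *\<^sub>v x - D *\<^sub>v x = 0\<^sub>v N"
      using kerD[OF x] dist[OF that] by simp
    moreover have "(D - C) *\<^sub>v x = - (C *\<^sub>v x - D *\<^sub>v x)"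
      unfolding dist[OF that(2,1)] using mult_V[OF that(1) xV] mult_V[OF that(2) xV]
        carrier_matD[OF H_carrier[OF that(1)]] carrier_matD[OF H_carrier[OF that(2)]]
      by (intro eq_vecI) (auto simp del: index_mult_mat_vec)
    ultimately show "x \<in> ker (D - C)"
      using xV by (simp add: ker_def)
  qed
  have "ker (A - B) = ker (B - A)"
    by (intro equalityI sub assms)
  then show ?thesis
    using rk_eq_iff_card_ker[of "A - B" "B - A" 0 0] assms by (simp add: H_minus)
qed

lemma rk_minus_eq_0_iff:
  assumes "A \<in> H" "B \<in> H"
  shows "rk (A - B) = 0 \<longleftrightarrow> A = B"
proof -
  have "A - B = 0\<^sub>m N N \<longleftrightarrow> A = B"
  proof
    assume eq: "A - B = 0\<^sub>m N N"
    show "A = B"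
    proof (rule eq_matI)
      fix i j assume "i < dim_row B" "j < dim_col B"
      then have ij: "i < N" "j < N"
        using H_carrier[OF assms(2)] by auto
      have "(A - B) $$ (i, j) = 0\<^sub>m N N $$ (i, j)"
        using eq by simp
      then show "A $$ (i, j) = B $$ (i, j)"
        using ij H_carrier[OF assms(1)] H_carrier[OF assms(2)] by simp
    qed (use H_carrier[OF assms(1)] H_carrier[OF assms(2)] in auto)
  qed (use H_carrier[OF assms(1)] in auto)
  then show ?thesis
    using rk_eq_0_iff[OF H_minus[OF assms]] by simp
qed

text \<open>Vectors are counted, not rank one matrices. The factor \<open>q + 1\<close> against the
  rank one adjacency matrix is not computed here; it emerges as \<open>c 1\<close> in
  \<open>S_eq\<close>.\<close>

definition step_matrix :: "'a mat \<Rightarrow> 'a mat \<Rightarrow> complex" where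
  "step_matrix x y = (if x \<in> H \<and> y \<in> H
     then of_nat (card {v \<in> V. v \<noteq> 0\<^sub>v N \<and> x - outer v = y}) else 0)"

text \<open>The vectors \<open>v\<close> are grouped by the intermediate point
  \<open>z = x - outer v\<close>.\<close>

lemma step_matrix_adj:
  assumes "x \<in> H" "y \<in> H"
  shows "mat_prod H step_matrix (adj_matrix (hermitian_rel q N j)) x y =
    of_nat (card {v \<in> V. v \<noteq> 0\<^sub>v N \<and> rk (x - y - outer v) = j})"
proof -
  let ?W = "{v \<in> V. v \<noteq> 0\<^sub>v N \<and> rk (x - y - outer v) = j}"
  have swap: "x - y - outer v = x - outer v - y" for v
    using H_carrier[OF assms(1)] H_carrier[OF assms(2)] carrier_matD[OF outer_carrier[of v]]
    by (intro eq_matI) auto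
  have "step_matrix x z * adj_matrix (hermitian_rel q N j) z y = of_nat (card {v \<in> ?W. x - outer v = z})"
    if "z \<in> H" for z
  proof (cases "rk (z - y) = j")
    case True
    then have "{v \<in> ?W. x - outer v = z} = {v \<in> V. v \<noteq> 0\<^sub>v N \<and> x - outer v = z}"
      using swap by auto
    then show ?thesis
      using True that assms by (simp add: step_matrix_def adj_matrix_def hermitian_rel_def)
  next
    case False
    then have "{v \<in> ?W. x - outer v = z} = {}"
      using swap by auto
    then show ?thesis
      using False by (simp add: adj_matrix_def hermitian_rel_def)
  qed
  then have "mat_prod H step_matrix (adj_matrix (hermitian_rel q N j)) x y =
      of_nat (\<Sum>z\<in>H. card {v \<in> ?W. x - outer v = z})"
    by (simp add: mat_prod_def)
  also have "(\<Sum>z\<in>H. card {v \<in> ?W. x - outer v = z}) = card ?W"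
    using sum.group[of ?W H "\<lambda>v. x - outer v" "\<lambda>_. 1::nat"] finite_H assms(1) minus_outer_H by auto
  finally show ?thesis .
qed

lemma metric_scheme_hermitian:
  assumes "N > 0"
  shows "metric_scheme H (hermitian_rel q N) N step_matrix
    (\<lambda>i. of_int (herm_c q i)) (\<lambda>i. of_int (herm_a q N i)) (\<lambda>i. of_int (herm_b q N i))"
proof
  fix i j :: nat and x y :: "'a mat"
  show "finite H"
    by (rule finite_H)
  show "hermitian_rel q N j \<subseteq> H \<times> H"
    by (auto simp: hermitian_rel_def)
  show "hermitian_rel q N i \<inter> (hermitian_rel q N j :: ('a mat \<times> 'a mat) set) = {}" if "i \<noteq> j"
    using that by (auto simp: hermitian_rel_def)
  show "(y, x) \<in> hermitian_rel q N j" if "(x, y) \<in> hermitian_rel q N j"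
    using that rk_minus_commute by (auto simp: hermitian_rel_def)
  show "hermitian_rel q N 0 = Id_on H"
    using rk_minus_eq_0_iff by (auto simp: hermitian_rel_def)
  show "hermitian_rel q N j \<noteq> ({} :: ('a mat \<times> 'a mat) set)" if "j \<le> N"
  proof -
    obtain A where A: "A \<in> H" "rk A = j"
      using exists_rk[OF \<open>j \<le> N\<close>] by blast
    moreover have "A - 0\<^sub>m N N = A"
      using H_carrier[OF A(1)] by (intro eq_matI) auto
    ultimately have "(A, 0\<^sub>m N N) \<in> hermitian_rel q N j"
      by (simp add: hermitian_rel_def H_zero)
    then show ?thesis
      by blast
  qed
  show "mat_prod H step_matrix (adj_matrix (hermitian_rel q N j)) = (\<lambda>x y. \<Sum>k\<le>N.
      tridiag (\<lambda>i. of_int (herm_c q i)) (\<lambda>i. of_int (herm_a q N i)) (\<lambda>i. of_int (herm_b q N i)) k j *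
      adj_matrix (hermitian_rel q N k) x y)" if "j \<le> N"
  proof (intro ext)
    fix x y :: "'a mat"
    let ?tri = "tridiag (\<lambda>i. of_int (herm_c q i)) (\<lambda>i. of_int (herm_a q N i)) (\<lambda>i. of_int (herm_b q N i)) :: nat \<Rightarrow> nat \<Rightarrow> complex"
    show "mat_prod H step_matrix (adj_matrix (hermitian_rel q N j)) x y =
      (\<Sum>k\<le>N. ?tri k j * adj_matrix (hermitian_rel q N k) x y)"
    proof (cases "x \<in> H \<and> y \<in> H")
      case True
      let ?r = "rk (x - y)"
      have xy: "x - y \<in> H"
        using True H_minus by blast
      have "mat_prod H step_matrix (adj_matrix (hermitian_rel q N j)) x y =
          of_int (int (card {v \<in> V. v \<noteq> 0\<^sub>v N \<and> rk (x - y - outer v) = j}))"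
        using step_matrix_adj[of x y j] True by simp
      also have "\<dots> = ?tri ?r j"
        unfolding card_rk_minus_outer[OF xy] by (simp add: tridiag_def)
      also have "\<dots> = (\<Sum>k\<le>N. if k = ?r then ?tri ?r j else 0)"
        using rk_le[OF xy] by simp
      also have "\<dots> = (\<Sum>k\<le>N. ?tri k j * adj_matrix (hermitian_rel q N k) x y)"
        using True by (intro sum.cong) (auto simp: adj_matrix_def hermitian_rel_def)
      finally show ?thesis .
    next
      case False
      then show ?thesis
        by (auto simp: mat_prod_def adj_matrix_def hermitian_rel_def step_matrix_def intro!: sum.neutral)
    qed
  qed
  show "step_matrix x y = 0" if "y \<notin> H"
    using that by (simp add: step_matrix_def)
  have "herm_c q j \<noteq> 0" if "0 < j" "j \<le> N"
  proof -
    have "int q ^ j > 1"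
      using that q_gt_1 by simp
    moreover have "(- 1 :: int) ^ j \<le> 1"
      by (cases "even j") auto
    ultimately show ?thesis
      using q_gt_1 by (simp add: herm_c_def)
  qed
  then show "of_int (herm_c q j) \<noteq> (0 :: complex)" if "0 < j" "j \<le> N"
    using that by simp
  show "of_int (herm_a q N 0) = (0 :: complex)"
    by (simp add: herm_a_def herm_b_def herm_c_def)
  show "N > 0"
    by fact
qed

end

theorem theorem5:
  fixes q N :: nat
    and E :: "nat \<Rightarrow> 'a::{field,finite} mat \<Rightarrow> 'a mat \<Rightarrow> complex"
    and P :: "complex mat"
  assumes "primepow q"
    and "CARD('a) = q ^ 2"
    and "N > 2"
    and "self_dual_ordering (hermitian_forms q N) (hermitian_rel q N) N E"
    and "is_first_eigenmatrix (hermitian_rel q N) N E P"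
  shows "\<not> (\<exists>T. T \<in> carrier_mat (N + 1) (N + 1) \<and> diagonal_mat T \<and>
              (P * T) ^\<^sub>m 3 = 1\<^sub>m (N + 1))"
proof -
  interpret hermitian_geometry q "TYPE('a)" N
    by unfold_locales (use assms in auto)
  define B :: complex where "B = - of_nat q"
  define M where "M = B ^ (2 * N)"
  define c where "c = (\<lambda>i. B ^ (i - 1) * (1 - B ^ i))"
  define b where "b = (\<lambda>i. M - B ^ (2 * i))"
  define a where "a = (\<lambda>i. M - 1 - b i - c i)"
  \<comment> \<open>For \<open>i > 0\<close> the signs combine as
    \<open>(-1)^(i-1) * (1 - (-q)^i) = q^i - (-1)^i\<close>; at \<open>i = 0\<close> both sides are
    zero.\<close>
  have c_eq: "(\<lambda>i. of_int (herm_c q i)) = c"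
  proof
    fix i
    have "B ^ i = (- 1) ^ i * of_nat q ^ i" for i
      unfolding B_def by (rule power_minus)
    then show "of_int (herm_c q i) = c i"
      by (cases i) (simp_all add: herm_c_def c_def algebra_simps flip: power_add power_mult_distrib)
  qed
  have b_eq: "(\<lambda>i. of_int (herm_b q N i)) = b"
    by (simp add: herm_b_def b_def M_def B_def)
  have a_eq: "(\<lambda>i. of_int (herm_a q N i)) = a"
    using fun_cong[OF c_eq] fun_cong[OF b_eq] by (simp add: herm_a_def a_def M_def B_def fun_eq_iff)
  interpret S: metric_scheme H "hermitian_rel q N" N step_matrix c a b
    by (rule metric_scheme_hermitian[unfolded c_eq a_eq b_eq]) (use assms(3) in simp)
  have bij: "bij_betw E {..N} (primitive_idempotents H (hermitian_rel q N) N)"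
    using assms(4) by (simp add: self_dual_ordering_def)
  interpret hermitian_eigenmatrix q N "of_nat (card H)" "\<lambda>i j. P $$ (i, j)" B M a b c
    "\<lambda>i. c 1 * P $$ (i, 1)" "\<lambda>i. M / B ^ i - 1"
  proof
    show "of_nat (card H) \<noteq> (0 :: complex)"
      using finite_H H_zero by auto
    show "P $$ (i, 0) = 1" if "i \<le> N" for i
      using S.P_col_0[OF bij assms(5) that] .
    show "c 1 * P $$ (i, 1) * P $$ (i, j) = (\<Sum>k\<le>N. P $$ (i, k) * tridiag c a b k j)"
      if "i \<le> N" "j \<le> N" for i j
      using S.P_recurrence[OF bij assms(5) that] .
    show "(\<Sum>k\<le>N. P $$ (i, k) * P $$ (k, j)) = (if i = j then of_nat (card H) else 0)"
      if "i \<le> N" "j \<le> N" for i j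
      using S.P_square[OF assms(4,5) that] .
  qed (use q_gt_1 assms(3) B_def M_def c_def b_def a_def in simp_all)
  have "P \<in> carrier_mat (N + 1) (N + 1)"
    using assms(5) by (simp add: is_first_eigenmatrix_def)
  then show ?thesis
    using no_diagonal_cube_root by blast
qed

end
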